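(* Let $K,L$ be number fields, $m \ge 2$ an integer, and $\sigma_m: G_K^m \to G_L^m$ a homomorphism of profinite groups such that $\sigma_m(G_K^m)$ is open in $G_L^m$ and $\sigma_m(G_K^m) \supseteq G_L^m[m-1]$. If $\tau, \rho: L_m \hookrightarrow K_m$ are field embeddings such that $\tau \circ \sigma_m(g) = g \circ \tau$ and $\rho \circ \sigma_m(g) = g \circ \rho$ for all $g \in G_K^m$, then $\tau = \rho$.
   Context: All homomorphisms of profinite groups are continuous. $G_K=\mathrm{Gal}(\overline{K}/K)$; for a profinite group $G$, $G[1]$ is the closure of the commutator subgroup, $G[i]$ the closure of $[G[i-1],G[i-1]]$, $G^m=G/G[m]$. $K_m$ is the fixed field of $G_K[m]$ in $\overline{K}$ (maximal $m$-step solvable extension of $K$), with $G_K^m=\mathrm{Gal}(K_m/K)$ acting on $K_m$; similarly for $L$. *)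

theory Defs
  imports
    "HOL-Algebra.Generated_Groups"
    "HOL-Analysis.Abstract_Topology"
    "HOL-Computational_Algebra.Polynomial"
begin

section \<open>Fields\<close>

text \<open>
  Fields are subfields (as sets) of an ambient field type. Below, the ambient type of a number
  field \<open>K\<close> is an arbitrary algebraically closed type all of whose elements are algebraic over
  \<open>K\<close>, i.e. the universe of the type is an algebraic closure of \<open>K\<close>.
\<close>

definition is_subfield :: "'a::field set \<Rightarrow> bool" where
  "is_subfield E \<longleftrightarrow>
     0 \<in> E \<and> 1 \<in> E \<and>
     (\<forall>x\<in>E. \<forall>y\<in>E. x + y \<in> E \<and> x * y \<in> E) \<and>
     (\<forall>x\<in>E. - x \<in> E \<and> inverse x \<in> E)"

definition is_finite_extension :: "'a::field set \<Rightarrow> 'a set \<Rightarrow> bool" where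
  "is_finite_extension F E \<longleftrightarrow>
     is_subfield F \<and> is_subfield E \<and> F \<subseteq> E \<and>
     (\<exists>B. finite B \<and> E = {\<Sum>b\<in>B. c b * b | c. \<forall>b\<in>B. c b \<in> F})"

definition number_field :: "'a::field_char_0 set \<Rightarrow> bool" where
  "number_field K \<longleftrightarrow> is_finite_extension \<rat> K"

definition ambient_algebraic_closure :: "'a::alg_closed_field set \<Rightarrow> bool" where
  "ambient_algebraic_closure K \<longleftrightarrow>
     is_subfield K \<and> (\<forall>x::'a. \<exists>p. p \<noteq> 0 \<and> (\<forall>i. coeff p i \<in> K) \<and> poly p x = 0)"

definition field_embedding :: "'b::field set \<Rightarrow> 'a::field set \<Rightarrow> ('b \<Rightarrow> 'a) \<Rightarrow> bool" where
  "field_embedding E F f \<longleftrightarrow>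
     f ` E \<subseteq> F \<and> inj_on f E \<and> f 1 = 1 \<and>
     (\<forall>x\<in>E. \<forall>y\<in>E. f (x + y) = f x + f y \<and> f (x * y) = f x * f y)"


section \<open>Topological groups\<close>

text \<open>
  A topological group is given by a group \<open>G\<close> together with a topology \<open>T\<close> on its carrier.
\<close>

primrec closed_derived :: "('g, 'x) monoid_scheme \<Rightarrow> 'g topology \<Rightarrow> nat \<Rightarrow> 'g set" where
  "closed_derived G T 0 = carrier G"
| "closed_derived G T (Suc i) = T closure_of (derived G (closed_derived G T i))"

definition quotient_topology :: "'g topology \<Rightarrow> ('g \<Rightarrow> 'h) \<Rightarrow> 'h topology" where
  "quotient_topology T f =
     topology (\<lambda>U. U \<subseteq> f ` topspace T \<and> openin T {x \<in> topspace T. f x \<in> U})"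

definition step_quotient :: "('g, 'x) monoid_scheme \<Rightarrow> 'g topology \<Rightarrow> nat \<Rightarrow> 'g set monoid" where
  "step_quotient G T m = G Mod closed_derived G T m"

definition step_quotient_topology ::
    "('g, 'x) monoid_scheme \<Rightarrow> 'g topology \<Rightarrow> nat \<Rightarrow> 'g set topology" where
  "step_quotient_topology G T m =
     quotient_topology T (\<lambda>g. closed_derived G T m #>\<^bsub>G\<^esub> g)"

lemma openin_quotient_topology:
  "openin (quotient_topology T f) U \<longleftrightarrow>
     U \<subseteq> f ` topspace T \<and> openin T {x \<in> topspace T. f x \<in> U}"
proof -
  have "istopology (\<lambda>U. U \<subseteq> f ` topspace T \<and> openin T {x \<in> topspace T. f x \<in> U})"
    unfolding istopology_def
  proof (intro conjI allI impI)
    fix S S' assume a: "S \<subseteq> f ` topspace T \<and> openin T {x \<in> topspace T. f x \<in> S}"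
      and b: "S' \<subseteq> f ` topspace T \<and> openin T {x \<in> topspace T. f x \<in> S'}"
    show "S \<inter> S' \<subseteq> f ` topspace T" using a by blast
    have "{x \<in> topspace T. f x \<in> S \<inter> S'} =
          {x \<in> topspace T. f x \<in> S} \<inter> {x \<in> topspace T. f x \<in> S'}" by blast
    moreover have "openin T ({x \<in> topspace T. f x \<in> S} \<inter> {x \<in> topspace T. f x \<in> S'})"
      using a b by (intro openin_Int) auto
    ultimately show "openin T {x \<in> topspace T. f x \<in> S \<inter> S'}" by (simp only:)
  next
    fix \<K> assume a: "\<forall>S\<in>\<K>. S \<subseteq> f ` topspace T \<and> openin T {x \<in> topspace T. f x \<in> S}"
    then show "\<Union>\<K> \<subseteq> f ` topspace T" by blast
    have "{x \<in> topspace T. f x \<in> \<Union>\<K>} = (\<Union>S\<in>\<K>. {x \<in> topspace T. f x \<in> S})" by blast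
    moreover have "openin T (\<Union>S\<in>\<K>. {x \<in> topspace T. f x \<in> S})"
      using a by (intro openin_Union) auto
    ultimately show "openin T {x \<in> topspace T. f x \<in> \<Union>\<K>}" by (simp only:)
  qed
  then show ?thesis
    by (simp add: quotient_topology_def topology_inverse')
qed

lemma topspace_quotient_topology: "topspace (quotient_topology T f) = f ` topspace T"
proof
  show "topspace (quotient_topology T f) \<subseteq> f ` topspace T"
    by (metis openin_quotient_topology openin_topspace)
  have "{x \<in> topspace T. f x \<in> f ` topspace T} = topspace T" by blast
  then have "openin (quotient_topology T f) (f ` topspace T)"
    by (simp add: openin_quotient_topology)
  then show "f ` topspace T \<subseteq> topspace (quotient_topology T f)"
    by (rule openin_subset)
qed

lemma quotient_map_quotient_topology: "quotient_map T (quotient_topology T f) f"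
  by (auto simp: quotient_map_def topspace_quotient_topology openin_quotient_topology)


section \<open>Absolute Galois groups and maximal \<open>m\<close>-step solvable extensions\<close>

definition abs_galois :: "'a::field set \<Rightarrow> ('a \<Rightarrow> 'a) monoid" where
  "abs_galois K =
     \<lparr> carrier = {f. bij f \<and> (\<forall>x y. f (x + y) = f x + f y \<and> f (x * y) = f x * f y)
                    \<and> (\<forall>x\<in>K. f x = x)},
       monoid.mult = (\<circ>), one = id \<rparr>"

definition krull_topology :: "'a::field set \<Rightarrow> ('a \<Rightarrow> 'a) topology" where
  "krull_topology K =
     topology_generated_by
       {g <#\<^bsub>abs_galois K\<^esub> carrier (abs_galois E) | g E.
          g \<in> carrier (abs_galois K) \<and> is_finite_extension K E}"

abbreviation galois_derived :: "'a::field set \<Rightarrow> nat \<Rightarrow> ('a \<Rightarrow> 'a) set" where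
  "galois_derived K m \<equiv> closed_derived (abs_galois K) (krull_topology K) m"

abbreviation step_galois :: "'a::field set \<Rightarrow> nat \<Rightarrow> ('a \<Rightarrow> 'a) set monoid" where
  "step_galois K m \<equiv> step_quotient (abs_galois K) (krull_topology K) m"

abbreviation step_topology :: "'a::field set \<Rightarrow> nat \<Rightarrow> ('a \<Rightarrow> 'a) set topology" where
  "step_topology K m \<equiv> step_quotient_topology (abs_galois K) (krull_topology K) m"

definition step_field :: "'a::field set \<Rightarrow> nat \<Rightarrow> 'a set" where
  "step_field K m = {x. \<forall>g\<in>galois_derived K m. g x = x}"

text \<open>
  The action of a coset on the fixed field: all representatives take the same value there
  (lemma \<open>step_act_coset\<close>), which is how the quotient is the Galois group of \<^term>\<open>step_field K m\<close>
  over \<open>K\<close>.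
\<close>

definition step_act :: "('a \<Rightarrow> 'a) set \<Rightarrow> 'a \<Rightarrow> 'a" where
  "step_act c x = (THE y. \<forall>g\<in>c. g x = y)"

lemma carrier_abs_galois_iff:
  "f \<in> carrier (abs_galois K) \<longleftrightarrow>
     bij f \<and> (\<forall>x y. f (x + y) = f x + f y \<and> f (x * y) = f x * f y) \<and> (\<forall>x\<in>K. f x = x)"
  by (simp add: abs_galois_def)

lemma mult_abs_galois [simp]: "f \<otimes>\<^bsub>abs_galois K\<^esub> g = f \<circ> g"
  by (simp add: abs_galois_def)

lemma one_abs_galois [simp]: "\<one>\<^bsub>abs_galois K\<^esub> = id"
  by (simp add: abs_galois_def)

lemma inv_into_in_abs_galois:
  assumes "f \<in> carrier (abs_galois K)"
  shows "inv_into UNIV f \<in> carrier (abs_galois K)"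
proof -
  have f: "bij f" "\<And>x y. f (x + y) = f x + f y" "\<And>x y. f (x * y) = f x * f y"
    "\<And>x. x \<in> K \<Longrightarrow> f x = x"
    using assms by (auto simp: carrier_abs_galois_iff)
  have i: "inj f" and s: "\<And>y. f (inv_into UNIV f y) = y"
    using f(1) by (auto simp: bij_def surj_f_inv_f)
  show ?thesis
    unfolding carrier_abs_galois_iff
  proof (intro conjI allI ballI)
    show "bij (inv_into UNIV f)" using f(1) by (rule bij_imp_bij_inv)
  next
    fix x y show "inv_into UNIV f (x + y) = inv_into UNIV f x + inv_into UNIV f y"
      by (rule injD[OF i]) (simp add: f s)
  next
    fix x y show "inv_into UNIV f (x * y) = inv_into UNIV f x * inv_into UNIV f y"
      by (rule injD[OF i]) (simp add: f s)
  next
    fix x assume "x \<in> K"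
    then have "f (inv_into UNIV f x) = f x" by (simp add: f(4) s)
    then show "inv_into UNIV f x = x" by (rule injD[OF i])
  qed
qed

lemma group_abs_galois: "group (abs_galois K)"
proof (rule groupI)
  fix f assume f: "f \<in> carrier (abs_galois K)"
  then have "inv_into UNIV f \<circ> f = id"
    by (auto simp: carrier_abs_galois_iff bij_def)
  then show "\<exists>y\<in>carrier (abs_galois K). y \<otimes>\<^bsub>abs_galois K\<^esub> f = \<one>\<^bsub>abs_galois K\<^esub>"
    using inv_into_in_abs_galois[OF f] by auto
qed (auto simp: carrier_abs_galois_iff bij_comp comp_assoc)

lemma inv_abs_galois:
  assumes "f \<in> carrier (abs_galois K)"
  shows "inv\<^bsub>abs_galois K\<^esub> f = inv_into UNIV f"
proof -
  interpret group "abs_galois K" by (rule group_abs_galois)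
  have "inv_into UNIV f \<circ> f = id"
    using assms by (auto simp: carrier_abs_galois_iff bij_def)
  then show ?thesis
    using assms inv_into_in_abs_galois[OF assms] by (intro inv_equality) auto
qed

lemma is_finite_extension_refl: "is_subfield K \<Longrightarrow> is_finite_extension K K"
  unfolding is_finite_extension_def
  by (intro conjI exI[of _ "{1}"]) auto

lemma is_finite_extension_image:
  assumes g: "g \<in> carrier (abs_galois K)" and E: "is_finite_extension K E"
  shows "is_finite_extension K (g ` E)"
proof -
  have b: "bij g" and a: "\<And>x y. g (x + y) = g x + g y" and m: "\<And>x y. g (x * y) = g x * g y"
    and fx: "\<And>x. x \<in> K \<Longrightarrow> g x = x"
    using g by (auto simp: carrier_abs_galois_iff)
  have sub: "is_subfield K" "is_subfield E" "K \<subseteq> E" using E by (auto simp: is_finite_extension_def)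
  obtain B where B: "finite B" "E = {\<Sum>b\<in>B. c b * b | c. \<forall>b\<in>B. c b \<in> K}"
    using E by (auto simp: is_finite_extension_def)
  have g0: "g 0 = 0" using a[of 0 0] by (metis add_0_right add_left_cancel)
  have g1: "g 1 = 1" using fx sub(1) by (simp add: is_subfield_def)
  have gm: "g (- x) = - g x" for x using a[of x "-x"] g0 by (simp add: eq_neg_iff_add_eq_0 add.commute)
  have gi: "g (inverse x) = inverse (g x)" for x
  proof (cases "x = 0")
    case False
    then have "g x * g (inverse x) = 1" using m[of x "inverse x"] g1 by simp
    then show ?thesis by (metis inverse_unique)
  qed (simp add: g0)
  have gs: "g (\<Sum>b\<in>B. c b * b) = (\<Sum>b\<in>B. c b * g b)" if "\<forall>b\<in>B. c b \<in> K" for c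
    using B(1) that by (induction B rule: finite_induct) (auto simp: g0 a m fx)
  have inj: "inj_on g B" using b by (meson bij_def inj_on_subset subset_UNIV)
  have "g ` E = {\<Sum>b\<in>g ` B. c b * b | c. \<forall>b\<in>g ` B. c b \<in> K}"
  proof (intro Set.set_eqI iffI)
    fix y assume "y \<in> g ` E"
    then obtain c where c: "\<forall>b\<in>B. c b \<in> K" "y = g (\<Sum>b\<in>B. c b * b)" using B(2) by auto
    have "y = (\<Sum>b\<in>g ` B. c (inv_into B g b) * b)"
      using c gs by (simp add: sum.reindex[OF inj] inv_into_f_f[OF inj])
    moreover have "\<forall>b\<in>g ` B. c (inv_into B g b) \<in> K"
      using c(1) by (simp add: inv_into_f_f[OF inj])
    ultimately show "y \<in> {\<Sum>b\<in>g ` B. c b * b | c. \<forall>b\<in>g ` B. c b \<in> K}"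
      by (intro CollectI exI[of _ "\<lambda>b. c (inv_into B g b)"] conjI)
  next
    fix y assume "y \<in> {\<Sum>b\<in>g ` B. c b * b | c. \<forall>b\<in>g ` B. c b \<in> K}"
    then obtain c where c: "\<forall>b\<in>g ` B. c b \<in> K" "y = (\<Sum>b\<in>g ` B. c b * b)" by auto
    then have "y = g (\<Sum>b\<in>B. c (g b) * b)"
      using gs[of "\<lambda>b. c (g b)"] by (simp add: sum.reindex[OF inj])
    moreover have "(\<Sum>b\<in>B. c (g b) * b) \<in> E"
      unfolding B(2) using c(1) by (intro CollectI exI[of _ "\<lambda>b. c (g b)"]) auto
    ultimately show "y \<in> g ` E" by blast
  qed
  moreover have "is_subfield (g ` E)"
    unfolding is_subfield_def
  proof (intro conjI ballI)
    show "0 \<in> g ` E" "1 \<in> g ` E"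
      using sub(2) g0 g1 by (metis is_subfield_def imageI)+
  next
    fix x y assume "x \<in> g ` E" "y \<in> g ` E"
    then obtain x' y' where "x' \<in> E" "y' \<in> E" "x = g x'" "y = g y'" by blast
    then show "x + y \<in> g ` E" "x * y \<in> g ` E"
      using sub(2) by (metis is_subfield_def imageI a m)+
  next
    fix x assume "x \<in> g ` E"
    then obtain x' where "x' \<in> E" "x = g x'" by blast
    then show "- x \<in> g ` E" "inverse x \<in> g ` E"
      using sub(2) by (metis is_subfield_def imageI gm gi)+
  qed
  moreover have "K \<subseteq> g ` E" using sub(3) fx by (metis image_eqI subset_iff)
  ultimately show ?thesis
    using sub(1) B(1) unfolding is_finite_extension_def by blast
qed

text \<open>Two elements agreeing on \<open>E\<close> lie in the same left coset of the Galois group of \<open>E\<close>.\<close>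

lemma l_coset_abs_galois:
  assumes "g \<in> carrier (abs_galois K)" "K \<subseteq> E"
  shows "g <#\<^bsub>abs_galois K\<^esub> carrier (abs_galois E) =
           {f \<in> carrier (abs_galois K). \<forall>x\<in>E. f x = g x}"
proof (intro Set.set_eqI iffI)
  fix f assume "f \<in> g <#\<^bsub>abs_galois K\<^esub> carrier (abs_galois E)"
  then obtain h where h: "h \<in> carrier (abs_galois E)" "f = g \<circ> h" by (auto simp: l_coset_def)
  then have "h \<in> carrier (abs_galois K)" using assms(2) by (auto simp: carrier_abs_galois_iff)
  then show "f \<in> {f \<in> carrier (abs_galois K). \<forall>x\<in>E. f x = g x}"
    using h assms(1) by (auto simp: carrier_abs_galois_iff bij_comp)
next
  fix f assume f: "f \<in> {f \<in> carrier (abs_galois K). \<forall>x\<in>E. f x = g x}"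
  interpret group "abs_galois K" by (rule group_abs_galois)
  let ?h = "inv_into UNIV g \<circ> f"
  have "?h \<in> carrier (abs_galois K)"
    using m_closed[OF inv_into_in_abs_galois[OF assms(1)]] f by auto
  moreover have "?h x = x" if "x \<in> E" for x
    using f that assms(1) by (auto simp: carrier_abs_galois_iff bij_def inv_f_f)
  ultimately have "?h \<in> carrier (abs_galois E)" by (simp add: carrier_abs_galois_iff)
  moreover have "f = g \<circ> ?h"
    using assms(1) by (auto simp: carrier_abs_galois_iff bij_def surj_f_inv_f)
  ultimately show "f \<in> g <#\<^bsub>abs_galois K\<^esub> carrier (abs_galois E)"
    by (auto simp: l_coset_def)
qed

definition krull_basis :: "'a::field set \<Rightarrow> ('a \<Rightarrow> 'a) set set" where
  "krull_basis K = {{f \<in> carrier (abs_galois K). \<forall>x\<in>E. f x = g x} | g E.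
                      g \<in> carrier (abs_galois K) \<and> is_finite_extension K E}"

lemma krull_topology_alt: "krull_topology K = topology_generated_by (krull_basis K)"
proof -
  have "K \<subseteq> E" if "is_finite_extension K E" for E
    using that by (simp add: is_finite_extension_def)
  then have "{g <#\<^bsub>abs_galois K\<^esub> carrier (abs_galois E) | g E.
          g \<in> carrier (abs_galois K) \<and> is_finite_extension K E} = krull_basis K"
    unfolding krull_basis_def
    by (intro Collect_cong ex_cong1) (auto simp: l_coset_abs_galois)
  then show ?thesis by (simp add: krull_topology_def)
qed

lemma topspace_krull_topology:
  assumes "is_subfield K" shows "topspace (krull_topology K) = carrier (abs_galois K)"
proof -
  have "{f \<in> carrier (abs_galois K). \<forall>x\<in>K. f x = id x} \<in> krull_basis K"
    unfolding krull_basis_def using is_finite_extension_refl[OF assms] 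
    by (auto simp: carrier_abs_galois_iff intro!: exI[of _ id] exI[of _ K])
  moreover have "{f \<in> carrier (abs_galois K). \<forall>x\<in>K. f x = id x} = carrier (abs_galois K)"
    by (auto simp: carrier_abs_galois_iff)
  ultimately show ?thesis
    by (auto simp: krull_topology_alt krull_basis_def)
qed

lemma continuous_map_krullI:
  assumes K: "is_subfield K"
    and c: "\<And>f. f \<in> carrier (abs_galois K) \<Longrightarrow> \<phi> f \<in> carrier (abs_galois K)"
    and v: "\<And>g E. g \<in> carrier (abs_galois K) \<Longrightarrow> is_finite_extension K E \<Longrightarrow>
              openin (krull_topology K) {f \<in> carrier (abs_galois K). \<forall>x\<in>E. \<phi> f x = g x}"
  shows "continuous_map (krull_topology K) (krull_topology K) \<phi>"
  unfolding krull_topology_alt[of K]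
proof (rule continuous_on_generated_topo)
  show "\<phi> ` topspace (topology_generated_by (krull_basis K)) \<subseteq> \<Union>(krull_basis K)"
    using c topspace_krull_topology[OF K] by (auto simp: krull_topology_alt)
next
  fix U assume "U \<in> krull_basis K"
  then obtain g E where gE: "g \<in> carrier (abs_galois K)" "is_finite_extension K E"
    "U = {f \<in> carrier (abs_galois K). \<forall>x\<in>E. f x = g x}" by (auto simp: krull_basis_def)
  have "\<phi> -` U \<inter> topspace (topology_generated_by (krull_basis K)) =
          {f \<in> carrier (abs_galois K). \<forall>x\<in>E. \<phi> f x = g x}"
    using c topspace_krull_topology[OF K] by (auto simp: krull_topology_alt gE)
  then show "openin (topology_generated_by (krull_basis K))
               (\<phi> -` U \<inter> topspace (topology_generated_by (krull_basis K)))"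
    using v[OF gE(1,2)] by (simp only: krull_topology_alt)
qed

lemma openin_krull_basis:
  assumes "g \<in> carrier (abs_galois K)" "is_finite_extension K E"
  shows "openin (krull_topology K) {f \<in> carrier (abs_galois K). \<forall>x\<in>E. f x = g x}"
  unfolding krull_topology_alt
  by (rule topology_generated_by_Basis) (use assms in \<open>auto simp: krull_basis_def\<close>)

lemma krull_left_translation:
  assumes K: "is_subfield K" and a: "a \<in> carrier (abs_galois K)"
  shows "continuous_map (krull_topology K) (krull_topology K) (\<lambda>f. a \<circ> f)"
proof (rule continuous_map_krullI[OF K])
  interpret group "abs_galois K" by (rule group_abs_galois)
  show "a \<circ> f \<in> carrier (abs_galois K)" if "f \<in> carrier (abs_galois K)" for f
    using m_closed[OF a that] by simp
  fix g E assume g: "g \<in> carrier (abs_galois K)" and E: "is_finite_extension K E"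
  have "inv_into UNIV a \<circ> g \<in> carrier (abs_galois K)"
    using m_closed[OF inv_into_in_abs_galois[OF a] g] by simp
  moreover have "(a \<circ> f) x = g x \<longleftrightarrow> f x = (inv_into UNIV a \<circ> g) x" for f x
    using a by (metis carrier_abs_galois_iff bij_inv_eq_iff comp_apply)
  ultimately show "openin (krull_topology K)
      {f \<in> carrier (abs_galois K). \<forall>x\<in>E. (a \<circ> f) x = g x}"
    using openin_krull_basis[OF _ E] by (simp only:)
qed

lemma krull_right_translation:
  assumes K: "is_subfield K" and a: "a \<in> carrier (abs_galois K)"
  shows "continuous_map (krull_topology K) (krull_topology K) (\<lambda>f. f \<circ> a)"
proof (rule continuous_map_krullI[OF K])
  interpret group "abs_galois K" by (rule group_abs_galois)
  show "f \<circ> a \<in> carrier (abs_galois K)" if "f \<in> carrier (abs_galois K)" for f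
    using m_closed[OF that a] by simp
  fix g E assume g: "g \<in> carrier (abs_galois K)" and E: "is_finite_extension K E"
  have "g \<circ> inv_into UNIV a \<in> carrier (abs_galois K)"
    using m_closed[OF g inv_into_in_abs_galois[OF a]] by simp
  moreover have "(\<forall>x\<in>E. (f \<circ> a) x = g x) \<longleftrightarrow> (\<forall>y\<in>a ` E. f y = (g \<circ> inv_into UNIV a) y)" for f
    using a by (auto simp: carrier_abs_galois_iff bij_def)
  ultimately show "openin (krull_topology K)
      {f \<in> carrier (abs_galois K). \<forall>x\<in>E. (f \<circ> a) x = g x}"
    using openin_krull_basis[OF _ is_finite_extension_image[OF a E]] by (simp only:)
qed

lemma krull_inversion:
  assumes K: "is_subfield K"
  shows "continuous_map (krull_topology K) (krull_topology K) (inv_into UNIV)"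
proof (rule continuous_map_krullI[OF K])
  show "inv_into UNIV f \<in> carrier (abs_galois K)" if "f \<in> carrier (abs_galois K)" for f
    using that by (rule inv_into_in_abs_galois)
  fix g E assume g: "g \<in> carrier (abs_galois K)" and E: "is_finite_extension K E"
  have "(\<forall>x\<in>E. inv_into UNIV f x = g x) \<longleftrightarrow> (\<forall>y\<in>g ` E. f y = inv_into UNIV g y)"
    if "f \<in> carrier (abs_galois K)" for f
  proof -
    have "inv_into UNIV f x = g x \<longleftrightarrow> f (g x) = inv_into UNIV g (g x)" for x
      using that g by (metis carrier_abs_galois_iff bij_inv_eq_iff)
    then show ?thesis by blast
  qed
  then have "{f \<in> carrier (abs_galois K). \<forall>x\<in>E. inv_into UNIV f x = g x} =
      {f \<in> carrier (abs_galois K). \<forall>y\<in>g ` E. f y = inv_into UNIV g y}"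
    by blast
  then show "openin (krull_topology K)
      {f \<in> carrier (abs_galois K). \<forall>x\<in>E. inv_into UNIV f x = g x}"
    using openin_krull_basis[OF inv_into_in_abs_galois[OF g] is_finite_extension_image[OF g E]]
    by (simp only:)
qed

lemma normal_krull_closure:
  assumes K: "is_subfield K" and N: "N \<lhd> abs_galois K"
  shows "krull_topology K closure_of N \<lhd> abs_galois K"
proof -
  interpret group "abs_galois K" by (rule group_abs_galois)
  interpret N: normal N "abs_galois K" by (rule N)
  let ?T = "krull_topology K"
  let ?C = "?T closure_of N"
  have CG: "?C \<subseteq> carrier (abs_galois K)"
    using closure_of_subset_topspace topspace_krull_topology[OF K] by metis
  have NC: "N \<subseteq> ?C"
    using N.subset by (intro closure_of_subset) (simp add: topspace_krull_topology[OF K])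
  have push: "\<phi> f \<in> ?C" if "continuous_map ?T ?T \<phi>" "\<phi> ` N \<subseteq> ?C" "f \<in> ?C" for \<phi> f
    using continuous_map_image_closure_subset[OF that(1), of N] that(2,3)
      closure_of_minimal[OF that(2) closedin_closure_of] by blast
  have l: "n \<circ> f \<in> ?C" if "n \<in> N" "f \<in> ?C" for n f
    using that(1) N.subset N.m_closed[OF that(1)] NC
    by (intro push[OF krull_left_translation[OF K] _ that(2)]) auto
  have r: "f \<circ> h \<in> ?C" if "f \<in> ?C" "h \<in> ?C" for f h
    using that CG l by (intro push[OF krull_right_translation[OF K] _ that(1)]) auto
  have i: "inv_into UNIV f \<in> ?C" if "f \<in> ?C" for f
  proof (rule push[OF krull_inversion[OF K] _ that])
    show "inv_into UNIV ` N \<subseteq> ?C"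
      using N.m_inv_closed NC N.subset by (auto simp flip: inv_abs_galois[of _ K])
  qed
  have sub: "subgroup ?C (abs_galois K)"
    using CG r i NC N.one_closed by (intro subgroup.intro) (auto simp: inv_abs_galois subset_iff)
  show ?thesis
  proof (rule normal_invI[OF sub])
    fix x h assume x: "x \<in> carrier (abs_galois K)" and h: "h \<in> ?C"
    have xi: "inv_into UNIV x \<in> carrier (abs_galois K)" using x by (rule inv_into_in_abs_galois)
    have "continuous_map ?T ?T ((\<lambda>f. f \<circ> inv_into UNIV x) \<circ> (\<lambda>f. x \<circ> f))"
      by (rule continuous_map_compose[OF krull_left_translation[OF K x]
            krull_right_translation[OF K xi]])
    moreover have "((\<lambda>f. f \<circ> inv_into UNIV x) \<circ> (\<lambda>f. x \<circ> f)) ` N \<subseteq> ?C"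
      using N.inv_op_closed2[OF x] NC by (auto simp: inv_abs_galois[OF x])
    ultimately show "x \<otimes>\<^bsub>abs_galois K\<^esub> h \<otimes>\<^bsub>abs_galois K\<^esub> inv\<^bsub>abs_galois K\<^esub> x \<in> ?C"
      using push[OF _ _ h] by (fastforce simp: inv_abs_galois[OF x])
  qed
qed

lemma normal_galois_derived:
  assumes "is_subfield K"
  shows "galois_derived K m \<lhd> abs_galois K"
proof (induction m)
  case 0
  interpret group "abs_galois K" by (rule group_abs_galois)
  show ?case by (auto intro!: normal_invI subgroup_self)
next
  case (Suc m)
  then show ?case
    using normal_krull_closure[OF assms] group.derived_is_normal[OF group_abs_galois] by auto
qed

lemma step_act_coset:
  assumes K: "is_subfield K" and x: "x \<in> step_field K m" and g: "g \<in> carrier (abs_galois K)"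
  shows "step_act (galois_derived K m #>\<^bsub>abs_galois K\<^esub> g) x = g x"
proof -
  interpret group "abs_galois K" by (rule group_abs_galois)
  interpret N: normal "galois_derived K m" "abs_galois K" by (rule normal_galois_derived[OF K])
  have "h (g x) = g x" if h: "h \<in> galois_derived K m" for h
  proof -
    have "inv_into UNIV g \<circ> h \<circ> g \<in> galois_derived K m"
      using N.inv_op_closed1[OF g h] by (simp add: inv_abs_galois[OF g])
    then have "(inv_into UNIV g \<circ> h \<circ> g) x = x" using x by (auto simp: step_field_def)
    then show ?thesis using g by (metis carrier_abs_galois_iff bij_inv_eq_iff comp_apply)
  qed
  then have "\<forall>f \<in> galois_derived K m #>\<^bsub>abs_galois K\<^esub> g. f x = g x"
    by (auto simp: r_coset_def)
  moreover have "g \<in> galois_derived K m #>\<^bsub>abs_galois K\<^esub> g"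
    using rcos_self[OF g N.subgroup_axioms] .
  ultimately show ?thesis
    unfolding step_act_def by - (rule the_equality, assumption, drule (1) bspec, simp)
qed

end

theory Submission
  imports Defs
begin

text \<open>
  Write \<open>m = i + 1\<close>, so that \<open>L\<^sub>m\<close> is the maximal abelian extension of \<open>L\<^sub>i\<close> and \<open>L\<^sub>i\<close> contains all roots of
  unity; by Kummer theory \<open>L\<^sub>m\<close> is spanned by radicals \<open>\<alpha>\<close> over \<open>L\<^sub>i\<close>. If \<open>h\<close> corresponds to \<open>g\<close> and
  \<open>h \<alpha> = \<zeta> \<alpha>\<close>, then \<open>g (\<tau> \<alpha>) = \<tau> \<zeta> \<cdot> \<tau> \<alpha>\<close>, and likewise for \<open>\<rho>\<close>.

  Roots of unity: let \<open>\<tau> \<zeta> = (\<rho> \<zeta>)\<^sup>c\<close> for a primitive \<open>n\<close>-th root of unity and let \<open>\<alpha>\<^sup>n = 2\<close>. Then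
  \<open>(\<rho> \<alpha>)\<^sup>c / \<tau> \<alpha>\<close> is Galois invariant, so it is an element of \<open>K\<close> whose \<open>n\<close>-th power is \<open>2\<^sup>c / 2\<close>.
  Bounded ramification at \<open>2\<close> forces \<open>n\<close> to divide \<open>(c - 1) d!\<close> for a fixed \<open>d\<close>, whence \<open>\<tau> = \<rho>\<close> on roots of
  unity.

  Radicals: let \<open>a \<in> L\<^sub>i\<close> be a power of \<open>\<alpha>\<close>. For every \<open>k\<close> and every \<open>k\<close>-th root \<open>\<beta>\<close> of \<open>\<alpha>\<close>, the quotient
  \<open>\<tau> \<beta> / \<rho> \<beta>\<close> is fixed by the Galois group of the number field \<open>K(\<tau> a)\<close>. Hence \<open>\<tau> \<alpha> / \<rho> \<alpha>\<close> is a
  \<open>k\<close>-th power in that number field for all \<open>k\<close>, so it is \<open>1\<close> in almost all finite residue fields, and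
  therefore equal to \<open>1\<close>.
\<close>

section \<open>Subrings and finite extensions\<close>

definition is_subring :: "'a::comm_ring_1 set \<Rightarrow> bool" where
  "is_subring A \<longleftrightarrow> 1 \<in> A \<and> (\<forall>x\<in>A. - x \<in> A) \<and> (\<forall>x\<in>A. \<forall>y\<in>A. x + y \<in> A \<and> x * y \<in> A)"

definition polys_over :: "'a::comm_ring_1 set \<Rightarrow> 'a poly set" where
  "polys_over A = {p. \<forall>i. coeff p i \<in> A}"

text \<open>The ring \<open>A[x]\<close>. When \<open>A\<close> is a field over which everything is
  algebraic, it is already the field \<open>A(x)\<close>, so one construction serves both field
  extensions and the enlargement of subrings.\<close>

definition adjoin :: "'a::comm_ring_1 set \<Rightarrow> 'a \<Rightarrow> 'a set" where
  "adjoin A x = {poly p x | p. p \<in> polys_over A}"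

context
  fixes A :: "'a::comm_ring_1 set"
  assumes A: "is_subring A"
begin

lemma subring_one: "1 \<in> A"
  and subring_uminus: "x \<in> A \<Longrightarrow> - x \<in> A"
  and subring_add: "x \<in> A \<Longrightarrow> y \<in> A \<Longrightarrow> x + y \<in> A"
  and subring_mult: "x \<in> A \<Longrightarrow> y \<in> A \<Longrightarrow> x * y \<in> A"
  using A by (auto simp: is_subring_def)

lemma subring_zero: "0 \<in> A"
  using subring_add[OF subring_one subring_uminus[OF subring_one]] by simp

lemma subring_diff: "x \<in> A \<Longrightarrow> y \<in> A \<Longrightarrow> x - y \<in> A"
  using subring_add[of x "- y"] subring_uminus[of y] by simp

lemma subring_power: "x \<in> A \<Longrightarrow> x ^ n \<in> A"
  by (induction n) (auto intro: subring_one subring_mult)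

lemma subring_sum: "(\<And>i. i \<in> I \<Longrightarrow> f i \<in> A) \<Longrightarrow> sum f I \<in> A"
  by (induction I rule: infinite_finite_induct) (auto intro: subring_zero subring_add)

lemma subring_of_nat: "of_nat n \<in> A"
  by (induction n) (auto intro: subring_zero subring_one subring_add)

lemma subring_of_int: "of_int k \<in> A"
  by (cases k) (auto intro: subring_of_nat subring_uminus subring_one subring_diff simp del: of_nat_Suc)

lemma poly_in_subring: "p \<in> polys_over A \<Longrightarrow> x \<in> A \<Longrightarrow> poly p x \<in> A"
  by (auto simp: poly_altdef polys_over_def intro!: subring_sum subring_mult subring_power)

lemma is_subring_adjoin: "is_subring (adjoin A x)"
  unfolding is_subring_def
proof (intro conjI ballI)
  show "1 \<in> adjoin A x"
    unfolding adjoin_def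
    by (rule CollectI, rule exI[of _ 1])
      (auto simp: polys_over_def coeff_1 intro: subring_zero subring_one)
next
  fix a assume "a \<in> adjoin A x"
  then obtain p where p: "p \<in> polys_over A" "a = poly p x" by (auto simp: adjoin_def)
  then have "- p \<in> polys_over A" by (auto simp: polys_over_def intro: subring_uminus)
  then show "- a \<in> adjoin A x" using p(2) poly_minus[of p x] unfolding adjoin_def by force
next
  fix a b assume "a \<in> adjoin A x" "b \<in> adjoin A x"
  then obtain p q where p: "p \<in> polys_over A" "a = poly p x" "q \<in> polys_over A" "b = poly q x"
    by (auto simp: adjoin_def)
  have "p + q \<in> polys_over A" using p by (auto simp: polys_over_def intro: subring_add)
  then show "a + b \<in> adjoin A x" using p poly_add[of p q x] unfolding adjoin_def by force
  have "p * q \<in> polys_over A"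
    using p by (auto simp: polys_over_def coeff_mult intro!: subring_sum subring_mult)
  then show "a * b \<in> adjoin A x" using p poly_mult[of p q x] unfolding adjoin_def by force
qed

lemma subset_adjoin: "A \<subseteq> adjoin A x"
proof
  fix a assume "a \<in> A"
  then have "[:a:] \<in> polys_over A"
    by (auto simp: polys_over_def coeff_pCons split: nat.split intro: subring_zero)
  then show "a \<in> adjoin A x"
    unfolding adjoin_def by (intro CollectI exI[of _ "[:a:]"]) auto
qed

lemma self_in_adjoin: "x \<in> adjoin A x"
proof -
  have "[:0, 1:] \<in> polys_over A"
    by (auto simp: polys_over_def coeff_pCons split: nat.split intro: subring_zero subring_one)
  then show ?thesis unfolding adjoin_def by (intro CollectI exI[of _ "[:0, 1:]"]) auto
qed

end

lemma subfield_imp_subring: "is_subfield F \<Longrightarrow> is_subring F"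
  by (auto simp: is_subfield_def is_subring_def)

lemma adjoin_subset: "is_subring B \<Longrightarrow> A \<subseteq> B \<Longrightarrow> x \<in> B \<Longrightarrow> adjoin A x \<subseteq> B"
  unfolding adjoin_def polys_over_def using poly_in_subring[of B] by (auto simp: polys_over_def subset_iff)

lemma ambient_algebraic_closureD:
  assumes "ambient_algebraic_closure F"
  shows "is_subfield F" "is_subring F" "\<exists>p\<in>polys_over F. p \<noteq> 0 \<and> poly p x = 0"
  using assms by (auto simp: ambient_algebraic_closure_def polys_over_def intro: subfield_imp_subring)

lemma ambient_algebraic_closure_mono:
  "ambient_algebraic_closure F \<Longrightarrow> is_subfield E \<Longrightarrow> F \<subseteq> E \<Longrightarrow> ambient_algebraic_closure E"
  unfolding ambient_algebraic_closure_def by (meson subset_iff)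

text \<open>For \<open>u \<noteq> 0\<close> a nonzero polynomial over \<open>F\<close> of least
  degree vanishing at \<open>u\<close> has constant term \<open>a \<noteq> 0\<close>, and
  \<open>a + u * poly q u = 0\<close> exhibits the inverse of \<open>u\<close> inside
  \<open>D\<close>.\<close>

lemma subring_over_algebraic_is_subfield:
  assumes F: "ambient_algebraic_closure F" and D: "is_subring D" "F \<subseteq> D"
  shows "is_subfield D"
proof -
  have inv: "inverse u \<in> D" if u: "u \<in> D" for u
  proof (cases "u = 0")
    case False
    define P where "P p \<longleftrightarrow> p \<in> polys_over F \<and> p \<noteq> 0 \<and> poly p u = 0" for p
    obtain p0 where "P p0" using ambient_algebraic_closureD(3)[OF F, of u] by (auto simp: P_def)
    then obtain p where p: "P p" and min: "\<And>q. P q \<Longrightarrow> degree p \<le> degree q"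
      using ex_has_least_nat[of P p0 degree] by auto
    obtain a q where pq: "p = pCons a q" by (rule pCons_cases)
    have q: "q \<in> polys_over F"
      unfolding polys_over_def
    proof (intro CollectI allI)
      fix i show "coeff q i \<in> F"
        using p by (auto simp: P_def polys_over_def pq coeff_pCons dest: spec[of _ "Suc i"])
    qed
    have "a \<in> F" using p by (auto simp: P_def polys_over_def pq coeff_pCons dest: spec[of _ 0])
    have eq: "a + u * poly q u = 0" using p by (simp add: P_def pq)
    have "a \<noteq> 0"
    proof
      assume "a = 0"
      then have "P q" using p q False eq by (auto simp: P_def pq)
      then show False using min[of q] \<open>a = 0\<close> by (auto simp: pq P_def)
    qed
    have "poly q u \<in> D" using q u adjoin_subset[OF D u] unfolding adjoin_def by blast
    moreover have "inverse a \<in> D"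
      using \<open>a \<in> F\<close> D(2) ambient_algebraic_closureD(1)[OF F] by (auto simp: is_subfield_def)
    ultimately have "- (inverse a * poly q u) \<in> D"
      by (intro subring_uminus[OF D(1)] subring_mult[OF D(1)])
    moreover have "inverse u = - (inverse a * poly q u)"
      using eq \<open>a \<noteq> 0\<close> False by (simp add: field_simps eq_neg_iff_add_eq_0)
    ultimately show ?thesis by simp
  qed (simp add: subring_zero[OF D(1)])
  show ?thesis
    unfolding is_subfield_def
    using inv D(1) subring_zero[OF D(1)] by (auto simp: is_subring_def)
qed

lemma finite_extension_adjoin:
  assumes F: "ambient_algebraic_closure F"
  shows "is_finite_extension F (adjoin F x)"
proof -
  note R = ambient_algebraic_closureD(2)[OF F]
  obtain p where p: "p \<in> polys_over F" "p \<noteq> 0" "poly p x = 0"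
    using ambient_algebraic_closureD(3)[OF F, of x] by auto
  define r where "r = degree p"
  define B where "B = (\<lambda>i. x ^ i) ` {..<r}"
  \<comment> \<open>\<open>is_finite_extension\<close> indexes coefficients by the spanning elements
    themselves, and powers of \<open>x\<close> may coincide. Working with closure of
    \<open>S\<close> under sums and scalars avoids indexing by exponents.\<close>
  define S where "S = {\<Sum>b\<in>B. c b * b | c. \<forall>b\<in>B. c b \<in> F}"
  have fin: "finite B" by (simp add: B_def)
  have S_add: "a + b \<in> S" if "a \<in> S" "b \<in> S" for a b
  proof -
    from that obtain c c' where "a = (\<Sum>b\<in>B. c b * b)" "\<forall>b\<in>B. c b \<in> F"
      "b = (\<Sum>b\<in>B. c' b * b)" "\<forall>b\<in>B. c' b \<in> F" by (auto simp: S_def)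
    then show ?thesis
      unfolding S_def
      by (intro CollectI exI[of _ "\<lambda>b. c b + c' b"]) (auto simp: algebra_simps sum.distrib subring_add[OF R])
  qed
  have S_scale: "k * a \<in> S" if "a \<in> S" "k \<in> F" for k a
  proof -
    from that obtain c where "a = (\<Sum>b\<in>B. c b * b)" "\<forall>b\<in>B. c b \<in> F" by (auto simp: S_def)
    then show ?thesis
      unfolding S_def using that(2)
      by (intro CollectI exI[of _ "\<lambda>b. k * c b"]) (auto simp: sum_distrib_left mult.assoc subring_mult[OF R])
  qed
  have S0: "0 \<in> S" unfolding S_def
    by (intro CollectI exI[of _ "\<lambda>b. 0"]) (auto simp: subring_zero[OF R])
  have S_sum: "sum f I \<in> S" if "\<And>i. i \<in> I \<Longrightarrow> f i \<in> S" for f :: "nat \<Rightarrow> 'a" and I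
    using that by (induction I rule: infinite_finite_induct) (auto simp: S0 S_add)
  have S_base: "b \<in> S" if "b \<in> B" for b
    unfolding S_def using that fin
    by (intro CollectI exI[of _ "\<lambda>b'. if b' = b then 1 else 0"])
      (auto simp: subring_zero[OF R] subring_one[OF R] if_distrib[of "\<lambda>t. t * _"] sum.delta cong: if_cong)
  have lc: "coeff p r \<noteq> 0" using p(2) by (simp add: r_def)
  have Fi: "inverse k \<in> F" if "k \<in> F" for k
    using ambient_algebraic_closureD(1)[OF F] that by (auto simp: is_subfield_def)
  \<comment> \<open>Solving \<open>poly p x = 0\<close> for its top power lets every
    \<open>x ^ j\<close> with \<open>j \<ge> r\<close> be rewritten through smaller powers.\<close>
  have eq: "x ^ r = (\<Sum>i<r. - (inverse (coeff p r) * coeff p i) * x ^ i)"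
  proof -
    have "0 = (\<Sum>i\<le>r. coeff p i * x ^ i)" using p(3) by (simp add: poly_altdef r_def)
    also have "\<dots> = (\<Sum>i<r. coeff p i * x ^ i) + coeff p r * x ^ r"
      by (simp add: lessThan_Suc_atMost[symmetric])
    finally have "coeff p r * x ^ r = - (\<Sum>i<r. coeff p i * x ^ i)"
      by (simp add: eq_neg_iff_add_eq_0 add.commute)
    then have "x ^ r = inverse (coeff p r) * - (\<Sum>i<r. coeff p i * x ^ i)"
      using lc by (metis left_inverse mult.assoc mult_1)
    then show ?thesis by (simp add: sum_distrib_left sum_negf mult.assoc)
  qed
  have pow: "x ^ j \<in> S" for j
  proof (induction j rule: less_induct)
    case (less j)
    show ?case
    proof (cases "j < r")
      case True
      then show ?thesis by (intro S_base) (auto simp: B_def)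
    next
      case False
      have "x ^ j = x ^ (j - r) * x ^ r" using False by (simp flip: power_add)
      also have "\<dots> = (\<Sum>i<r. - (inverse (coeff p r) * coeff p i) * x ^ (j - r + i))"
        by (subst eq) (simp add: sum_distrib_left power_add mult_ac sum_negf)
      also have "\<dots> \<in> S"
      proof (rule S_sum)
        fix i assume i: "i \<in> {..<r}"
        have "- (inverse (coeff p r) * coeff p i) \<in> F"
          using p(1) by (auto simp: polys_over_def intro!: subring_uminus[OF R] subring_mult[OF R] Fi)
        then show "- (inverse (coeff p r) * coeff p i) * x ^ (j - r + i) \<in> S"
          using False i less by (intro S_scale) auto
      qed
      finally show ?thesis .
    qed
  qed
  have "adjoin F x \<subseteq> S"
    by (auto simp: adjoin_def poly_altdef polys_over_def intro!: S_sum S_scale pow)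
  moreover have "S \<subseteq> adjoin F x"
  proof -
    note RA = is_subring_adjoin[OF R, of x]
    have "x ^ i \<in> adjoin F x" for i
      by (intro subring_power[OF RA] self_in_adjoin[OF R])
    then show ?thesis using subset_adjoin[OF R, of x]
      by (auto simp: S_def B_def intro!: subring_sum[OF RA] subring_mult[OF RA])
  qed
  ultimately have "adjoin F x = S" by blast
  then show ?thesis
    unfolding is_finite_extension_def
    using ambient_algebraic_closureD(1)[OF F] subset_adjoin[OF R, of x] fin S_def
      subring_over_algebraic_is_subfield[OF F is_subring_adjoin[OF R, of x] subset_adjoin[OF R, of x]]
    by blast
qed


section \<open>Extension of automorphisms\<close>

text \<open>Partial automorphisms are handled through their graphs, which are subrings of the product
  ring; the last condition says that the graph is single-valued.\<close>

definition partial_aut :: "'a::field set \<Rightarrow> ('a \<times> 'a) set \<Rightarrow> bool" where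
  "partial_aut F R \<longleftrightarrow>
     (\<forall>k\<in>F. (k, k) \<in> R) \<and>
     (\<forall>a a' b b'. (a, a') \<in> R \<longrightarrow> (b, b') \<in> R \<longrightarrow> (a + b, a' + b') \<in> R \<and> (a * b, a' * b') \<in> R) \<and>
     (\<forall>a. (0, a) \<in> R \<longrightarrow> a = 0)"

text \<open>The map that \<open>R\<close> induces on polynomials, again as a graph: \<open>q\<close>
  is \<open>p\<close> transported along \<open>R\<close>.\<close>

definition poly_pairs :: "('a::zero \<times> 'b::zero) set \<Rightarrow> ('a poly \<times> 'b poly) set" where
  "poly_pairs R = {(p, q). \<forall>i. (coeff p i, coeff q i) \<in> R}"

context
  fixes F :: "'a::alg_closed_field set" and R :: "('a \<times> 'a) set"
  assumes F: "ambient_algebraic_closure F" and R: "partial_aut F R"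
begin

lemma partial_aut_fix: "k \<in> F \<Longrightarrow> (k, k) \<in> R"
  and partial_aut_add: "(a, a') \<in> R \<Longrightarrow> (b, b') \<in> R \<Longrightarrow> (a + b, a' + b') \<in> R"
  and partial_aut_mult: "(a, a') \<in> R \<Longrightarrow> (b, b') \<in> R \<Longrightarrow> (a * b, a' * b') \<in> R"
  and partial_aut_zero: "(0, a) \<in> R \<Longrightarrow> a = 0"
  using R by (auto simp: partial_aut_def)

lemma partial_aut_0: "(0, 0) \<in> R" and partial_aut_1: "(1, 1) \<in> R"
  using partial_aut_fix subring_zero subring_one ambient_algebraic_closureD(2)[OF F] by blast+

lemma partial_aut_uminus: "(a, a') \<in> R \<Longrightarrow> (- a, - a') \<in> R"
proof -
  assume a: "(a, a') \<in> R"
  have "(- 1, - 1) \<in> R"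
    using partial_aut_fix subring_uminus subring_one ambient_algebraic_closureD(2)[OF F] by blast
  from partial_aut_mult[OF this a] show ?thesis by simp
qed

lemma partial_aut_diff: "(a, a') \<in> R \<Longrightarrow> (b, b') \<in> R \<Longrightarrow> (a - b, a' - b') \<in> R"
  using partial_aut_add[of a a' "- b" "- b'"] partial_aut_uminus by simp

lemma partial_aut_sum:
  "(\<And>i. i \<in> I \<Longrightarrow> (f i, g i) \<in> R) \<Longrightarrow> (sum f I, sum g I) \<in> R"
  by (induction I rule: infinite_finite_induct) (auto intro: partial_aut_0 partial_aut_add)

lemma partial_aut_single_valued: "(a, b) \<in> R \<Longrightarrow> (a, c) \<in> R \<Longrightarrow> b = c"
  using partial_aut_diff[of a b a c] partial_aut_zero[of "b - c"] by simp

lemma poly_pairs_diff: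
  "(p, p') \<in> poly_pairs R \<Longrightarrow> (q, q') \<in> poly_pairs R \<Longrightarrow> (p - q, p' - q') \<in> poly_pairs R"
  unfolding poly_pairs_def using partial_aut_diff by simp

lemma poly_pairs_add:
  "(p, p') \<in> poly_pairs R \<Longrightarrow> (q, q') \<in> poly_pairs R \<Longrightarrow> (p + q, p' + q') \<in> poly_pairs R"
  unfolding poly_pairs_def using partial_aut_add by simp

lemma poly_pairs_mult:
  assumes "(p, p') \<in> poly_pairs R" "(q, q') \<in> poly_pairs R"
  shows "(p * q, p' * q') \<in> poly_pairs R"
proof -
  have "(coeff p i * coeff q j, coeff p' i * coeff q' j) \<in> R" for i j
    using assms by (intro partial_aut_mult) (auto simp: poly_pairs_def)
  then show ?thesis
    unfolding poly_pairs_def by (simp add: coeff_mult partial_aut_sum)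
qed

lemma poly_pairs_monom: "(a, a') \<in> R \<Longrightarrow> (monom a n, monom a' n) \<in> poly_pairs R"
  unfolding poly_pairs_def using partial_aut_0 by (simp add: coeff_monom)

lemma is_subfield_partial_aut_Domain: "is_subfield (Domain R)"
proof (rule subring_over_algebraic_is_subfield[OF F])
  show "is_subring (Domain R)"
    unfolding is_subring_def
    by (blast intro: partial_aut_1 partial_aut_uminus partial_aut_add partial_aut_mult)
qed (auto intro: partial_aut_fix)

text \<open>The domain of \<open>R\<close> is a field, so a nonzero \<open>a\<close> sent to
  \<open>0\<close> has an inverse there, and multiplying the two pairs would give
  \<open>(1, 0) \<in> R\<close>.\<close>

lemma partial_aut_inj: "(a, 0) \<in> R \<Longrightarrow> a = 0"
proof (rule ccontr)
  assume a: "(a, 0) \<in> R" "a \<noteq> 0"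
  then have "inverse a \<in> Domain R"
    using is_subfield_partial_aut_Domain by (auto simp: is_subfield_def)
  then obtain b where "(inverse a, b) \<in> R" by blast
  from partial_aut_mult[OF a(1) this] a(2) have "(1, 0) \<in> R" by simp
  with partial_aut_1 partial_aut_single_valued show False by fastforce
qed

text \<open>Division with remainder by the minimal polynomial \<open>p\<close> shows that sending \<open>u\<close> to \<open>v\<close> is
  well defined.\<close>

lemma partial_aut_extend:
  assumes p: "(p, p') \<in> poly_pairs R" "lead_coeff p = 1" "poly p u = 0" "poly p' v = 0"
    and min: "\<forall>q\<in>polys_over (Domain R). q \<noteq> 0 \<longrightarrow> poly q u = 0 \<longrightarrow> degree p \<le> degree q"
  defines "R' \<equiv> {(poly q u, poly q' v) | q q'. (q, q') \<in> poly_pairs R}"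
  shows "partial_aut F R'" "R \<subseteq> R'" "(u, v) \<in> R'"
proof -
  have zero: "poly q' v = 0" if "(q, q') \<in> poly_pairs R" "poly q u = 0" for q q'
    using that
  proof (induction "degree q" arbitrary: q q' rule: less_induct)
    case less
    show ?case
    proof (cases "q = 0")
      case True
      then have "coeff q' i = 0" for i
        using less.prems(1) partial_aut_zero by (auto simp: poly_pairs_def)
      then have "q' = 0" by (simp add: poly_eq_iff)
      then show ?thesis by simp
    next
      case False
      have qD: "q \<in> polys_over (Domain R)" using less.prems(1) by (auto simp: polys_over_def poly_pairs_def)
      have le: "degree p \<le> degree q" using min qD False less.prems(2) by blast
      have p0: "degree p > 0"
      proof (rule ccontr)
        assume "\<not> degree p > 0"
        then obtain a where "p = [:a:]" by (auto elim: degree_eq_zeroE)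
        with p(2,3) show False by simp
      qed
      define r where "r = monom (lead_coeff q) (degree q - degree p)"
      \<comment> \<open>The coefficient of \<open>q'\<close> is taken at \<open>degree q\<close>,
        since the degree of \<open>q'\<close> itself is not known and \<open>r'\<close> must be the
        transport of \<open>r\<close>.\<close>
      define r' where "r' = monom (coeff q' (degree q)) (degree q - degree p)"
      have rr: "(r, r') \<in> poly_pairs R"
        unfolding r_def r'_def using less.prems(1)
        by (intro poly_pairs_monom) (auto simp: poly_pairs_def)
      let ?q = "q - r * p" and ?q' = "q' - r' * p'"
      have pr: "(?q, ?q') \<in> poly_pairs R"
        by (intro poly_pairs_diff poly_pairs_mult less.prems rr p)
      have ev: "poly ?q u = 0" using less.prems(2) p(3) by simp
      have dr: "degree (r * p) = degree q"
      proof -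
        have "p \<noteq> 0" "r \<noteq> 0" using p(2) False by (auto simp: r_def monom_eq_0_iff)
        then have "degree (r * p) = degree r + degree p" by (simp add: degree_mult_eq)
        then show ?thesis using le False by (simp add: r_def degree_monom_eq)
      qed
      have "coeff (r * p) (degree q) = lead_coeff q"
        using dr p(2) False by (metis lead_coeff_monom lead_coeff_mult mult.right_neutral r_def)
      then have c: "coeff ?q (degree q) = 0" by simp
      have "degree ?q < degree q"
      proof -
        have "degree ?q \<le> degree q" by (rule degree_diff_le) (use dr in auto)
        moreover have "degree ?q \<noteq> degree q"
        proof
          assume d: "degree ?q = degree q"
          then have "lead_coeff ?q = 0" using c by simp
          then have "?q = 0" by (simp only: leading_coeff_0_iff)
          then show False using d le p0 by simp
        qed
        ultimately show ?thesis by simp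
      qed
      from less.hyps[OF this pr ev] show ?thesis using p(4) by simp
    qed
  qed
  have const: "(poly [:a:] u, poly [:a':] v) \<in> R'" if "(a, a') \<in> R" for a a'
  proof -
    have "([:a:], [:a':]) \<in> poly_pairs R" using poly_pairs_monom[OF that, of 0] by (simp add: monom_0)
    then show ?thesis unfolding R'_def by blast
  qed
  show RR: "R \<subseteq> R'" using const by fastforce
  have "(monom 1 1, monom 1 1) \<in> poly_pairs R" by (intro poly_pairs_monom partial_aut_1)
  then have "(poly (monom 1 1) u, poly (monom 1 1) v) \<in> R'" unfolding R'_def by blast
  then show "(u, v) \<in> R'" by (simp add: poly_monom)
  show "partial_aut F R'"
    unfolding partial_aut_def
  proof (intro conjI allI ballI impI)
    fix k assume "k \<in> F" then show "(k, k) \<in> R'" using RR partial_aut_fix by blast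
  next
    fix a a' b b' assume "(a, a') \<in> R'" "(b, b') \<in> R'"
    then obtain q q' s s' where q: "(q, q') \<in> poly_pairs R" "(s, s') \<in> poly_pairs R"
      "a = poly q u" "a' = poly q' v" "b = poly s u" "b' = poly s' v" by (auto simp: R'_def)
    show "(a + b, a' + b') \<in> R'"
      using poly_pairs_add[OF q(1,2)] q(3-6) poly_add[of q s u] poly_add[of q' s' v] unfolding R'_def by force
    show "(a * b, a' * b') \<in> R'"
      using poly_pairs_mult[OF q(1,2)] q(3-6) poly_mult[of q s u] poly_mult[of q' s' v] unfolding R'_def by force
  next
    fix a assume "(0, a) \<in> R'"
    then show "a = 0" using zero by (auto simp: R'_def)
  qed
qed

end

section \<open>Automorphisms of the algebraic closure and their fixed field\<close>

lemma obtain_minimal_poly: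
  assumes "ambient_algebraic_closure F"
  obtains p where "p \<in> polys_over F" "lead_coeff p = 1" "poly p x = 0" "degree p > 0"
    "\<forall>q\<in>polys_over F. q \<noteq> 0 \<longrightarrow> poly q x = 0 \<longrightarrow> degree p \<le> degree q"
proof -
  define P where "P p \<longleftrightarrow> p \<in> polys_over F \<and> p \<noteq> 0 \<and> poly p x = 0" for p
  obtain p0 where "P p0" using ambient_algebraic_closureD(3)[OF assms, of x] by (auto simp: P_def)
  then obtain p where p: "P p" and min: "\<And>q. P q \<Longrightarrow> degree p \<le> degree q"
    using ex_has_least_nat[of P p0 degree] by auto
  let ?p = "smult (inverse (lead_coeff p)) p"
  have lc: "lead_coeff p \<noteq> 0" using p by (auto simp: P_def)
  have dp: "degree ?p = degree p" using lc by simp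
  show ?thesis
  proof (rule that[of ?p])
    have "inverse (lead_coeff p) \<in> F"
      using p ambient_algebraic_closureD(1)[OF assms] by (auto simp: P_def polys_over_def is_subfield_def)
    then show "?p \<in> polys_over F"
      using p ambient_algebraic_closureD(2)[OF assms] by (auto simp: P_def polys_over_def intro: subring_mult)
    show "lead_coeff ?p = 1" using lc by simp
    show "poly ?p x = 0" using p by (simp add: P_def)
    show "degree ?p > 0"
    proof (rule ccontr)
      assume "\<not> degree ?p > 0"
      then obtain a where "p = [:a:]" using dp by (auto elim: degree_eq_zeroE)
      with p show False by (simp add: P_def)
    qed
    show "\<forall>q\<in>polys_over F. q \<noteq> 0 \<longrightarrow> poly q x = 0 \<longrightarrow> degree ?p \<le> degree q"
      using min dp by (simp add: P_def)
  qed
qed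

text \<open>Zorn's lemma gives a maximal partial automorphism. It is total: for an element outside
  its domain, the minimal polynomial can be transported, and sending the element to a root of the
  transported polynomial extends the map.\<close>

lemma partial_aut_extends_to_automorphism:
  assumes F: "ambient_algebraic_closure F" and R0: "partial_aut F R0"
  shows "\<exists>f\<in>carrier (abs_galois F). \<forall>(a, b)\<in>R0. f a = b"
proof -
  define \<A> where "\<A> = {R. partial_aut F R \<and> R0 \<subseteq> R}"
  have "\<exists>M\<in>\<A>. \<forall>X\<in>\<A>. M \<subseteq> X \<longrightarrow> X = M"
  proof (rule subset_Zorn_nonempty)
    show "\<A> \<noteq> {}" using R0 by (auto simp: \<A>_def)
    fix \<C> assume ne: "\<C> \<noteq> {}" and ch: "subset.chain \<A> \<C>"
    have mem: "partial_aut F R" "R0 \<subseteq> R" if "R \<in> \<C>" for R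
      using ch that by (auto simp: subset_chain_def \<A>_def)
    have "partial_aut F (\<Union>\<C>)"
      unfolding partial_aut_def
    proof (intro conjI ballI allI impI)
      fix k assume "k \<in> F" then show "(k, k) \<in> \<Union>\<C>"
        using ne mem(1) partial_aut_fix[OF F] by blast
    next
      fix a a' b b' assume "(a, a') \<in> \<Union>\<C>" "(b, b') \<in> \<Union>\<C>"
      then obtain X Y where XY: "X \<in> \<C>" "Y \<in> \<C>" "(a, a') \<in> X" "(b, b') \<in> Y" by blast
      then have "X \<subseteq> Y \<or> Y \<subseteq> X" using ch by (auto simp: subset_chain_def)
      then obtain Z where Z: "Z \<in> \<C>" "(a, a') \<in> Z" "(b, b') \<in> Z" using XY by blast
      show "(a + b, a' + b') \<in> \<Union>\<C>" "(a * b, a' * b') \<in> \<Union>\<C>"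
        using partial_aut_add[OF F mem(1)[OF Z(1)] Z(2,3)] partial_aut_mult[OF F mem(1)[OF Z(1)] Z(2,3)] Z(1)
        by blast+
    next
      fix a assume "(0, a) \<in> \<Union>\<C>" then show "a = 0"
        using mem(1) partial_aut_zero[OF F] by blast
    qed
    then show "\<Union>\<C> \<in> \<A>" using ne mem(2) by (auto simp: \<A>_def)
  qed
  then obtain R where "R \<in> \<A>" and m: "\<forall>X\<in>\<A>. R \<subseteq> X \<longrightarrow> X = R" by blast
  then have R: "partial_aut F R" "R0 \<subseteq> R" by (auto simp: \<A>_def)
  have max: "X = R" if "partial_aut F X" "R \<subseteq> X" for X
    using m that R(2) by (auto simp: \<A>_def)
  define f where "f a = (THE b. (a, b) \<in> R)" for a
  have fI: "f a = b" if "(a, b) \<in> R" for a b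
    unfolding f_def using that partial_aut_single_valued[OF F R(1)] by blast
  have D: "Domain R = UNIV"
  proof (rule ccontr)
    assume "Domain R \<noteq> UNIV"
    then obtain u where u: "u \<notin> Domain R" by blast
    have FD: "F \<subseteq> Domain R" using partial_aut_fix[OF F R(1)] by blast
    have alg: "ambient_algebraic_closure (Domain R)"
      by (rule ambient_algebraic_closure_mono[OF F is_subfield_partial_aut_Domain[OF F R(1)] FD])
    obtain p where p: "p \<in> polys_over (Domain R)" "lead_coeff p = 1" "poly p u = 0" "degree p > 0"
      "\<forall>q\<in>polys_over (Domain R). q \<noteq> 0 \<longrightarrow> poly q u = 0 \<longrightarrow> degree p \<le> degree q"
      using obtain_minimal_poly[OF alg] by blast
    have f0: "f 0 = 0" "f 1 = 1" by (auto intro: fI partial_aut_0[OF F R(1)] partial_aut_1[OF F R(1)])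
    define p' where "p' = map_poly f p"
    have c': "coeff p' i = f (coeff p i)" for i by (simp add: p'_def coeff_map_poly f0)
    have pp: "(p, p') \<in> poly_pairs R"
      using p(1) fI by (fastforce simp: poly_pairs_def polys_over_def c')
    \<comment> \<open>Monicity keeps the transported polynomial nonconstant, so it has a
      root.\<close>
    have "coeff p' (degree p) = 1" using p(2) by (simp add: c' f0)
    then have "degree p' > 0" using p(4) le_degree[of p' "degree p"] by simp
    then obtain v where "poly p' v = 0" using alg_closed_imp_poly_has_root by blast
    from partial_aut_extend[OF F R(1) pp p(2,3) this p(5)] max u show False by blast
  qed
  have gr: "(a, f a) \<in> R" for a using D fI by blast
  have hom: "f (a + b) = f a + f b" "f (a * b) = f a * f b" for a b
    by (auto intro!: fI partial_aut_add[OF F R(1)] partial_aut_mult[OF F R(1)] gr)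
  have fix': "f k = k" if "k \<in> F" for k by (rule fI) (rule partial_aut_fix[OF F R(1) that])
  have inj: "inj f"
  proof (rule injI)
    fix a b assume "f a = f b"
    then have "(a - b, 0) \<in> R" using partial_aut_diff[OF F R(1) gr[of a] gr[of b]] by simp
    then show "a = b" using partial_aut_inj[OF F R(1)] by force
  qed
  \<comment> \<open>An injective map fixing \<open>F\<close> permutes the finite root set of each
    nonzero polynomial over \<open>F\<close>, and every element is such a root.\<close>
  have surj: "b \<in> range f" for b
  proof -
    obtain p where p: "p \<in> polys_over F" "p \<noteq> 0" "poly p b = 0"
      using ambient_algebraic_closureD(3)[OF F] by blast
    have f0: "f 0 = 0" by (rule fI[OF partial_aut_0[OF F R(1)]])
    have f_sum: "f (sum h I) = (\<Sum>i\<in>I. f (h i))" for h and I :: "nat set"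
      by (induction I rule: infinite_finite_induct) (auto simp: f0 hom)
    have f_pow: "f (a ^ n) = f a ^ n" for a n
      by (induction n) (auto simp: hom fI[OF partial_aut_1[OF F R(1)]])
    have "poly p (f a) = f (poly p a)" for a
      using p(1) by (simp add: poly_altdef f_sum hom f_pow polys_over_def fix')
    then have "f ` {a. poly p a = 0} \<subseteq> {a. poly p a = 0}" by (auto simp: f0)
    then have "f ` {a. poly p a = 0} = {a. poly p a = 0}"
      using poly_roots_finite[OF p(2)] by (meson endo_inj_surj inj inj_on_subset subset_UNIV)
    then show ?thesis using p(3) by blast
  qed
  show ?thesis
  proof (intro bexI[of _ f])
    show "f \<in> carrier (abs_galois F)"
      using inj surj hom fix' by (auto simp: carrier_abs_galois_iff bij_def)
    show "\<forall>(a, b)\<in>R0. f a = b" using R(2) fI by blast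
  qed
qed

text \<open>Any root of the minimal polynomial \<open>p\<close> of \<open>x\<close> is the image of
  \<open>x\<close> under some automorphism. If all of them fix \<open>x\<close>, then
  \<open>p = (X - x)^n\<close>, and in characteristic zero \<open>x\<close> is recovered from the
  coefficient \<open>- n x\<close> of \<open>X^(n-1)\<close>.\<close>

lemma fixed_field_abs_galois:
  fixes F :: "'a::{alg_closed_field,field_char_0} set"
  assumes F: "ambient_algebraic_closure F"
    and x: "\<And>f. f \<in> carrier (abs_galois F) \<Longrightarrow> f x = x"
  shows "x \<in> F"
proof (rule ccontr)
  assume nx: "x \<notin> F"
  note R = ambient_algebraic_closureD(2)[OF F]
  have Id: "partial_aut F (Id_on F)"
    using R by (auto simp: partial_aut_def Id_on_def is_subring_def)
  obtain p where p: "p \<in> polys_over F" "lead_coeff p = 1" "poly p x = 0" "degree p > 0"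
      "\<forall>q\<in>polys_over F. q \<noteq> 0 \<longrightarrow> poly q x = 0 \<longrightarrow> degree p \<le> degree q"
    using obtain_minimal_poly[OF F] by blast
  have pp: "(p, p) \<in> poly_pairs (Id_on F)" using p(1) by (auto simp: poly_pairs_def polys_over_def)
  have uniq: "y = x" if y: "poly p y = 0" for y
  proof -
    have "\<forall>q\<in>polys_over (Domain (Id_on F)). q \<noteq> 0 \<longrightarrow> poly q x = 0 \<longrightarrow> degree p \<le> degree q"
      using p(5) by simp
    note ext = partial_aut_extend[OF F Id pp p(2,3) y this]
    obtain f where f: "f \<in> carrier (abs_galois F)"
      and fR: "\<forall>(a, b)\<in>{(poly q x, poly q' y) | q q'. (q, q') \<in> poly_pairs (Id_on F)}. f a = b"
      using partial_aut_extends_to_automorphism[OF F ext(1)] ..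
    have "f x = y" using bspec[OF fR ext(3)] by (simp only: prod.case)
    with x[OF f] show ?thesis by simp
  qed
  have p0: "p \<noteq> 0" using p(4) by auto
  obtain n q where q: "p = [:-x, 1:] ^ n * q" "\<not> [:-x, 1:] dvd q"
    using order_decomp[OF p0] by blast
  have "degree q = 0"
  proof (rule ccontr)
    assume "degree q \<noteq> 0"
    then obtain y where y: "poly q y = 0" using alg_closed_imp_poly_has_root by blast
    then have "poly p y = 0" by (subst q(1)) simp
    then have "y = x" by (rule uniq)
    with y q(2) show False by (simp add: poly_eq_0_iff_dvd)
  qed
  then obtain c where "q = [:c:]" by (auto elim: degree_eq_zeroE)
  with q(1) have pc: "p = smult c ([:-x, 1:] ^ n)" by (simp add: mult.commute)
  have "lead_coeff (smult c ([:-x, 1:] ^ n)) = c"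
    by (simp only: lead_coeff_smult lead_coeff_power) simp
  then have "c = 1" using p(2)[unfolded pc] by argo
  then have pn: "p = [:-x, 1:] ^ n" using pc by simp
  have n0: "n > 0" using p(4) by (simp add: pn degree_linear_power)
  have "n choose (n - 1) = n" using n0 by (cases n) auto
  then have "coeff p (n - 1) = of_nat n * (- x)"
    unfolding pn using n0 by (subst coeff_linear_poly_power) auto
  moreover have "coeff p (n - 1) \<in> F" using p(1) by (simp add: polys_over_def)
  ultimately have "of_nat n * (- x) \<in> F" by simp
  moreover have "inverse (of_nat n) \<in> F"
    using ambient_algebraic_closureD(1)[OF F] subring_of_nat[OF R] by (auto simp: is_subfield_def)
  ultimately have "- (inverse (of_nat n) * (of_nat n * (- x))) \<in> F"
    using subring_uminus[OF R] subring_mult[OF R] by blast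
  then show False using nx n0 by (simp flip: mult.assoc)
qed


section \<open>Valuation rings over primes\<close>

definition valuation_ring :: "'a::field set \<Rightarrow> bool" where
  "valuation_ring V \<longleftrightarrow> is_subring V \<and> (\<forall>x. x \<in> V \<or> inverse x \<in> V)"

text \<open>The maximal ideal of \<open>V\<close>. Zero is listed separately because
  \<open>inverse 0 = 0\<close> lies in \<open>V\<close>.\<close>

definition nonunits :: "'a::field set \<Rightarrow> 'a set" where
  "nonunits V = {x \<in> V. x = 0 \<or> inverse x \<notin> V}"

section \<open>Existence of valuation rings\<close>

lemma sum_inverse_powers_mult_power:
  fixes x :: "'a::field"
  assumes "x \<noteq> 0"
  shows "(\<Sum>i\<le>n. c i * inverse x ^ i) * x ^ n = (\<Sum>i\<le>n. c i * x ^ (n - i))"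
  unfolding sum_distrib_right
  by (rule sum.cong) (use assms in \<open>auto simp: power_diff field_simps\<close>)

text \<open>If \<open>1/\<pi>\<close> is a polynomial in \<open>x\<close> and a polynomial in \<open>1/x\<close>, the longer of the two can be
  shortened, because \<open>1 - \<pi> b\<close> is invertible for every \<open>b\<close> in a maximal subring avoiding \<open>1/\<pi>\<close>.\<close>

lemma shorten_poly_rep:
  fixes x :: "'a::field"
  assumes A: "is_subring A" and pi: "\<pi> \<in> A" "\<pi> \<noteq> 0" and x: "x \<noteq> 0"
    and unit: "\<And>b. b \<in> A \<Longrightarrow> inverse (1 - \<pi> * b) \<in> A \<and> 1 - \<pi> * b \<noteq> 0"
    and f: "f \<in> polys_over A" "\<pi> * poly f x = 1"
    and g: "g \<in> polys_over A" "\<pi> * poly g (inverse x) = 1"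
    and le: "degree g \<le> degree f"
  obtains f' where "f' \<in> polys_over A" "\<pi> * poly f' x = 1" "degree f' < degree f"
proof -
  note [intro] = subring_zero[OF A] subring_mult[OF A] subring_diff[OF A] subring_add[OF A]
    subring_one[OF A] subring_sum[OF A]
  define n where "n = degree f"
  define u where "u = inverse (1 - \<pi> * coeff g 0)"
  have u: "u \<in> A" "u * (1 - \<pi> * coeff g 0) = 1"
    using unit[of "coeff g 0"] g(1) by (auto simp: polys_over_def u_def)
  have gn: "poly g (inverse x) * x ^ n = (\<Sum>i\<le>n. coeff g i * x ^ (n - i))"
  proof -
    have "poly g (inverse x) = (\<Sum>i\<le>n. coeff g i * inverse x ^ i)"
      unfolding poly_altdef using le
      by (intro sum.mono_neutral_left) (auto simp: n_def intro: coeff_eq_0)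
    then show ?thesis using sum_inverse_powers_mult_power[OF x] by simp
  qed
  have f0: "n > 0"
  proof (rule ccontr)
    assume "\<not> n > 0"
    then obtain a where "f = [:a:]" by (auto simp: n_def elim: degree_eq_zeroE)
    then have "a \<in> A" "\<pi> * a = 1" using f by (auto simp: polys_over_def dest: spec[of _ 0])
    then show False using unit[of a] by simp
  qed
  \<comment> \<open>The relation in \<open>1/x\<close>, multiplied by \<open>x ^ n\<close>,
    expresses \<open>(1 - \<pi> * coeff g 0) * x ^ n\<close> through lower powers of
    \<open>x\<close>, collected in \<open>s\<close>. The factor is a unit, so the leading monomial
    of \<open>f\<close> can be replaced by a multiple of \<open>s\<close>.\<close>
  define s where "s = (\<Sum>i=1..n. monom (coeff g i) (n - i))"
  have s: "poly s x = (\<Sum>i=1..n. coeff g i * x ^ (n - i))" by (simp add: s_def poly_sum poly_monom)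
  have range0: "{..n} = insert 0 {1..n}" by auto
  have key: "x ^ n = u * \<pi> * poly s x"
  proof -
    have "x ^ n = \<pi> * (poly g (inverse x) * x ^ n)" using g(2) by (simp flip: mult.assoc)
    also have "\<dots> = \<pi> * (coeff g 0 * x ^ n + poly s x)"
      unfolding gn s range0 by simp
    finally have "(1 - \<pi> * coeff g 0) * x ^ n = \<pi> * poly s x" by (simp add: algebra_simps)
    then have "u * ((1 - \<pi> * coeff g 0) * x ^ n) = u * (\<pi> * poly s x)" by simp
    then show ?thesis using u(2) by (simp flip: mult.assoc)
  qed
  define f' where "f' = f - monom (coeff f n) n + smult (coeff f n * u * \<pi>) s"
  have sA: "s \<in> polys_over A"
    using g(1) unfolding s_def polys_over_def
    by (auto simp: coeff_sum coeff_monom intro!: subring_sum[OF A])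
  have ds: "degree s < n"
  proof -
    have "degree s \<le> n - 1" unfolding s_def
    proof (rule degree_sum_le)
      fix i assume "i \<in> {1..n}"
      then have "n - i \<le> n - 1" by auto
      with degree_monom_le show "degree (monom (coeff g i) (n - i)) \<le> n - 1" by (rule order.trans)
    qed simp
    then show ?thesis using f0 by simp
  qed
  show ?thesis
  proof (rule that)
    show "f' \<in> polys_over A"
      using f(1) sA u(1) pi(1) by (auto simp: f'_def polys_over_def coeff_monom
          intro!: subring_add[OF A] subring_mult[OF A])
    have "poly f' x = poly f x - coeff f n * x ^ n + coeff f n * (u * \<pi> * poly s x)"
      by (simp add: f'_def poly_monom algebra_simps)
    also have "\<dots> = poly f x" unfolding key[symmetric] by simp
    finally show "\<pi> * poly f' x = 1" using f(2) by simp
    have "degree (f - monom (coeff f n) n) < n"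
    proof (rule degree_lessI)
      show "f - monom (coeff f n) n \<noteq> 0 \<or> n > 0" using f0 by simp
      show "\<forall>k\<ge>n. coeff (f - monom (coeff f n) n) k = 0"
        by (auto simp: coeff_monom n_def intro!: coeff_eq_0)
    qed
    then show "degree f' < degree f"
      unfolding f'_def n_def[symmetric] using ds
      using le_less_trans[OF degree_smult_le ds] by (intro degree_add_less) auto
  qed
qed

text \<open>Take \<open>V\<close> maximal among the subrings that contain \<open>\<pi>\<close> and
  omit \<open>1/\<pi>\<close>. If \<open>x\<close> and \<open>1/x\<close> both lay outside
  \<open>V\<close>, then \<open>1/\<pi>\<close> would be a polynomial in each of them over
  \<open>V\<close>; two such polynomials of least degree contradict
  \<open>shorten_poly_rep\<close>.\<close>

lemma valuation_ring_exists:
  assumes pi: "(\<pi>::'a::field) \<noteq> 0" and A0: "is_subring A0" "\<pi> \<in> A0" "inverse \<pi> \<notin> A0"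
  obtains V where "valuation_ring V" "\<pi> \<in> nonunits V"
proof -
  define \<A> where "\<A> = {A. is_subring A \<and> \<pi> \<in> A \<and> inverse \<pi> \<notin> A}"
  have "\<exists>M\<in>\<A>. \<forall>X\<in>\<A>. M \<subseteq> X \<longrightarrow> X = M"
  proof (rule subset_Zorn_nonempty)
    show "\<A> \<noteq> {}" using A0 by (auto simp: \<A>_def)
    fix \<C> assume ne: "\<C> \<noteq> {}" and ch: "subset.chain \<A> \<C>"
    have mem: "is_subring A" "\<pi> \<in> A" "inverse \<pi> \<notin> A" if "A \<in> \<C>" for A
      using ch that by (auto simp: subset_chain_def \<A>_def)
    have "is_subring (\<Union>\<C>)"
      unfolding is_subring_def
    proof (intro conjI ballI)
      show "1 \<in> \<Union>\<C>" using ne mem(1) subring_one by blast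
      show "- a \<in> \<Union>\<C>" if "a \<in> \<Union>\<C>" for a using that mem(1) subring_uminus by blast
      fix a b assume "a \<in> \<Union>\<C>" "b \<in> \<Union>\<C>"
      then obtain X Y where XY: "X \<in> \<C>" "Y \<in> \<C>" "a \<in> X" "b \<in> Y" by blast
      then have "X \<subseteq> Y \<or> Y \<subseteq> X" using ch by (auto simp: subset_chain_def)
      then obtain Z where Z: "Z \<in> \<C>" "a \<in> Z" "b \<in> Z" using XY by blast
      show "a + b \<in> \<Union>\<C>" "a * b \<in> \<Union>\<C>"
        using subring_add[OF mem(1)[OF Z(1)] Z(2,3)] subring_mult[OF mem(1)[OF Z(1)] Z(2,3)] Z(1)
        by blast+
    qed
    then show "\<Union>\<C> \<in> \<A>" using ne mem(2,3) by (auto simp: \<A>_def)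
  qed
  then obtain V where "V \<in> \<A>" and m: "\<forall>X\<in>\<A>. V \<subseteq> X \<longrightarrow> X = V" by blast
  then have V: "is_subring V" and piV: "\<pi> \<in> V" "inverse \<pi> \<notin> V" by (auto simp: \<A>_def)
  have max: "x \<in> V" if "inverse \<pi> \<notin> adjoin V x" for x
  proof -
    have "adjoin V x \<in> \<A>"
      using that is_subring_adjoin[OF V, of x] subset_adjoin[OF V, of x] piV by (auto simp: \<A>_def)
    then have "adjoin V x = V" using m subset_adjoin[OF V, of x] by blast
    then show ?thesis using self_in_adjoin[OF V, of x] by blast
  qed
  have ex: "\<exists>f\<in>polys_over V. \<pi> * poly f x = 1" if "x \<notin> V" for x
  proof -
    have "inverse \<pi> \<in> adjoin V x" using that max by blast
    then obtain f where "f \<in> polys_over V" "inverse \<pi> = poly f x" by (auto simp: adjoin_def)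
    then show ?thesis using pi by (metis right_inverse)
  qed
  have unit: "inverse (1 - \<pi> * b) \<in> V \<and> 1 - \<pi> * b \<noteq> 0" if b: "b \<in> V" for b
  proof -
    define v where "v = 1 - \<pi> * b"
    have v: "v \<in> V" unfolding v_def
      by (intro subring_diff[OF V] subring_one[OF V] subring_mult[OF V] piV b)
    have v0: "v \<noteq> 0"
    proof
      assume "v = 0"
      then have "b = inverse \<pi>" using pi by (simp add: v_def inverse_unique)
      then show False using b piV by simp
    qed
    \<comment> \<open>Powers of \<open>v\<close> are \<open>1\<close> modulo \<open>\<pi>\<close>.
      If \<open>1/v\<close> were outside \<open>V\<close>, clearing denominators in
      \<open>\<pi> * poly f (inverse v) = 1\<close> would also make a power of \<open>v\<close> a
      multiple of \<open>\<pi>\<close>, which puts \<open>1/\<pi>\<close> into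
      \<open>V\<close>.\<close>
    have pow: "\<exists>c\<in>V. v ^ k = 1 - \<pi> * c" for k
    proof (induction k)
      case 0 show ?case using subring_zero[OF V] by (intro bexI[of _ 0]) auto
    next
      case (Suc k)
      then obtain c where c: "c \<in> V" "v ^ k = 1 - \<pi> * c" by blast
      have "v ^ Suc k = v * (1 - \<pi> * c)" by (simp add: c(2))
      also have "\<dots> = 1 - \<pi> * (b + v * c)" by (simp add: v_def algebra_simps)
      finally show ?case
        using c b v by (intro bexI[of _ "b + v * c"]) (auto intro!: subring_add[OF V] subring_mult[OF V])
    qed
    have "inverse v \<in> V"
    proof (rule ccontr)
      assume "inverse v \<notin> V"
      then obtain f where f: "f \<in> polys_over V" "\<pi> * poly f (inverse v) = 1" using ex by blast
      have "poly f (inverse v) * v ^ degree f \<in> V"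
      proof -
        have "poly f (inverse v) * v ^ degree f = (\<Sum>i\<le>degree f. coeff f i * v ^ (degree f - i))"
          unfolding poly_altdef by (rule sum_inverse_powers_mult_power[OF v0])
        also have "\<dots> \<in> V" using f(1) v
          by (intro subring_sum[OF V] subring_mult[OF V] subring_power[OF V]) (auto simp: polys_over_def)
        finally show ?thesis .
      qed
      then obtain e where e: "e \<in> V" "e = poly f (inverse v) * v ^ degree f" by blast
      obtain c where c: "c \<in> V" "v ^ degree f = 1 - \<pi> * c" using pow by blast
      have "\<pi> * e = v ^ degree f" using e(2) f(2) by (simp flip: mult.assoc)
      then have "\<pi> * (e + c) = 1" using c(2) by (simp add: algebra_simps)
      then have "inverse \<pi> = e + c" by (rule inverse_unique)
      then show False using piV e c subring_add[OF V] by metis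
    qed
    then show ?thesis using v0 by (simp add: v_def)
  qed
  have "x \<in> V \<or> inverse x \<in> V" for x
  proof (rule ccontr)
    assume "\<not> (x \<in> V \<or> inverse x \<in> V)"
    then have n: "x \<notin> V" "inverse x \<notin> V" by auto
    then have x0: "x \<noteq> 0" using subring_zero[OF V] by auto
    define P where "P y f \<longleftrightarrow> f \<in> polys_over V \<and> \<pi> * poly f y = 1" for y f
    have "\<exists>f. P y f \<and> (\<forall>g. P y g \<longrightarrow> degree f \<le> degree g)" if "y \<notin> V" for y
      using ex[OF that] ex_has_least_nat[of "P y" _ degree] by (auto simp: P_def)
    then obtain f g where fg: "P x f" "\<forall>h. P x h \<longrightarrow> degree f \<le> degree h"
      "P (inverse x) g" "\<forall>h. P (inverse x) h \<longrightarrow> degree g \<le> degree h" using n by metis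
    show False
    proof (cases "degree g \<le> degree f")
      case True
      obtain f' where "P x f'" "degree f' < degree f"
        by (rule shorten_poly_rep[OF V piV(1) pi x0 unit _ _ _ _ True]) (use fg in \<open>auto simp: P_def\<close>)
      then show False using fg by force
    next
      case False
      then have le: "degree f \<le> degree g" by simp
      have x0': "inverse x \<noteq> 0" using x0 by simp
      obtain f' where "P (inverse x) f'" "degree f' < degree g"
        by (rule shorten_poly_rep[OF V piV(1) pi x0' unit _ _ _ _ le]) (use fg in \<open>auto simp: P_def\<close>)
      then show False using fg by force
    qed
  qed
  then show ?thesis
    using that V piV by (auto simp: valuation_ring_def nonunits_def)
qed

text \<open>The maximal subring is taken above the integers, which contain \<open>p\<close> but not
  \<open>1/p\<close>.\<close>

lemma valuation_ring_over_prime: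
  assumes "prime p"
  obtains V :: "'a::field_char_0 set" where "valuation_ring V" "of_nat p \<in> nonunits V"
proof (rule valuation_ring_exists)
  have p0: "p > 0" using assms prime_gt_0_nat by blast
  show "of_nat p \<noteq> (0::'a)" using p0 by simp
  show "is_subring (\<int>::'a set)" by (auto simp: is_subring_def)
  show "of_nat p \<in> (\<int>::'a set)" by simp
  show "inverse (of_nat p) \<notin> (\<int>::'a set)"
  proof
    assume "inverse (of_nat p) \<in> (\<int>::'a set)"
    then obtain k where "inverse (of_nat p) = (of_int k :: 'a)" by (auto elim: Ints_cases)
    then have "of_int (int p * k) = (1::'a)" using p0 by (simp add: field_simps)
    then have "int p * k = 1" by (metis of_int_eq_1_iff)
    then have "int p dvd 1" by (metis dvd_triv_left)
    then show False using assms by (simp add: prime_nat_iff)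
  qed
qed

section \<open>The maximal ideal of a valuation ring, and integrality\<close>

context
  fixes V :: "'a::field set"
  assumes V: "valuation_ring V"
begin

lemma vr_subring: "is_subring V"
  using V by (simp add: valuation_ring_def)

lemma nonunits_subset: "x \<in> nonunits V \<Longrightarrow> x \<in> V"
  by (simp add: nonunits_def)

lemma nonunits_zero: "0 \<in> nonunits V"
  using subring_zero[OF vr_subring] by (simp add: nonunits_def)

lemma one_notin_nonunits: "1 \<notin> nonunits V"
  using subring_one[OF vr_subring] by (simp add: nonunits_def)

lemma nonunits_mult: "x \<in> nonunits V \<Longrightarrow> y \<in> V \<Longrightarrow> x * y \<in> nonunits V"
proof -
  assume x: "x \<in> nonunits V" and y: "y \<in> V"
  have "inverse x \<in> V" if "inverse (x * y) \<in> V" "x * y \<noteq> 0"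
    using subring_mult[OF vr_subring that(1) y] that(2) by (simp add: field_simps)
  then show ?thesis
    using x subring_mult[OF vr_subring _ y] by (auto simp: nonunits_def)
qed

lemma nonunits_uminus: "x \<in> nonunits V \<Longrightarrow> - x \<in> nonunits V"
  using nonunits_mult[of x "- 1"] subring_uminus[OF vr_subring subring_one[OF vr_subring]] by simp

text \<open>One of \<open>x / y\<close> and \<open>y / x\<close> lies in \<open>V\<close>, so the
  sum is a nonunit times an element of \<open>V\<close>.\<close>

lemma nonunits_add:
  assumes "x \<in> nonunits V" "y \<in> nonunits V" shows "x + y \<in> nonunits V"
proof -
  have *: "x + y \<in> nonunits V"
    if "x \<in> nonunits V" "y \<in> nonunits V" "x / y \<in> V" "y \<noteq> 0" for x y
  proof -
    have "y * (x / y + 1) \<in> nonunits V"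
      using that by (intro nonunits_mult subring_add[OF vr_subring] subring_one[OF vr_subring])
    moreover have "y * (x / y + 1) = x + y" using that(4) by (simp add: distrib_left)
    ultimately show ?thesis by simp
  qed
  show ?thesis
  proof (cases "x = 0 \<or> y = 0")
    case True then show ?thesis using assms by auto
  next
    case False
    have "x / y \<in> V \<or> y / x \<in> V"
      using V unfolding valuation_ring_def by (metis inverse_divide)
    then show ?thesis using *[of x y] *[of y x] False assms by (auto simp: add.commute)
  qed
qed

lemma nonunits_diff: "x \<in> nonunits V \<Longrightarrow> y \<in> nonunits V \<Longrightarrow> x - y \<in> nonunits V"
  using nonunits_add[of x "- y"] nonunits_uminus by simp

lemma nonunits_sum: "(\<And>i. i \<in> I \<Longrightarrow> f i \<in> nonunits V) \<Longrightarrow> sum f I \<in> nonunits V"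
  by (induction I rule: infinite_finite_induct) (auto intro: nonunits_zero nonunits_add)

lemma nonunits_if_not_inverse: "x \<notin> V \<Longrightarrow> inverse x \<in> nonunits V"
  using V by (auto simp: nonunits_def valuation_ring_def)

text \<open>If \<open>x\<close> were outside \<open>V\<close>, its inverse would be inside, and
  \<open>x\<close> is \<open>x ^ n\<close> times a power of that inverse.\<close>

lemma root_in_valuation_ring:
  assumes "x ^ n \<in> V" "n > 0" shows "x \<in> V"
proof (rule ccontr)
  assume x: "x \<notin> V"
  then have "inverse x \<in> V" using V by (auto simp: valuation_ring_def)
  then have "x ^ n * inverse x ^ (n - 1) \<in> V"
    by (intro subring_mult[OF vr_subring] subring_power[OF vr_subring] assms)
  moreover have "x \<noteq> 0" using x subring_zero[OF vr_subring] by auto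
  then have "x ^ n * inverse x ^ (n - 1) = x"
    using assms(2) by (cases n) (auto simp: field_simps)
  ultimately show False using x by simp
qed

end

context
  fixes V :: "'a::field_char_0 set" and p :: nat
  assumes V: "valuation_ring V" and pV: "of_nat p \<in> nonunits V" and p: "prime p"
begin

text \<open>The residue field has characteristic \<open>p\<close>: for an integer prime to
  \<open>p\<close>, a Bezout relation would place \<open>1\<close> among the nonunits.\<close>

lemma of_int_in_nonunits_iff: "of_int k \<in> nonunits V \<longleftrightarrow> int p dvd k"
proof
  assume "int p dvd k"
  then obtain j where "k = int p * j" by (elim dvdE)
  then show "of_int k \<in> nonunits V"
    using nonunits_mult[OF V pV subring_of_int[OF vr_subring[OF V], of j]] by simp
next
  assume k: "of_int k \<in> nonunits V"
  show "int p dvd k"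
  proof (rule ccontr)
    assume "\<not> int p dvd k"
    then have "coprime (int p) k" using p by (simp add: prime_imp_coprime)
    then obtain a b where "a * int p + b * k = 1" by (metis bezout_int coprime_imp_gcd_eq_1)
    then have "of_nat p * of_int a + of_int k * of_int b = (1::'a)"
      by (metis mult.commute of_int_1 of_int_add of_int_mult of_int_of_nat_eq)
    moreover have "of_nat p * of_int a + of_int k * of_int b \<in> nonunits V"
      by (intro nonunits_add[OF V] nonunits_mult[OF V] pV k subring_of_int[OF vr_subring[OF V]])
    ultimately show False using one_notin_nonunits[OF V] by simp
  qed
qed

text \<open>If \<open>x\<close> were outside \<open>V\<close>, dividing the relation by
  \<open>x ^ n\<close> would write \<open>c n\<close> as a sum of multiples of the nonunit
  \<open>1/x\<close>.\<close>

lemma algebraic_in_valuation_ring: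
  assumes eq: "(\<Sum>i\<le>n. of_int (c i) * x ^ i) = 0" and c: "\<not> int p dvd c n"
  shows "x \<in> V"
proof (rule ccontr)
  assume x: "x \<notin> V"
  then have x0: "x \<noteq> 0" using subring_zero[OF vr_subring[OF V]] by auto
  define y where "y = inverse x"
  have y: "y \<in> nonunits V" unfolding y_def by (rule nonunits_if_not_inverse[OF V x])
  have "0 = (\<Sum>i\<le>n. of_int (c i) * x ^ i) * y ^ n" using eq by simp
  also have "\<dots> = (\<Sum>i\<le>n. of_int (c i) * y ^ (n - i))"
    using sum_inverse_powers_mult_power[of y] x0 by (simp add: y_def)
  also have "\<dots> = of_int (c n) + (\<Sum>i<n. of_int (c i) * y ^ (n - i))"
    by (simp add: lessThan_Suc_atMost[symmetric] add.commute)
  finally have "of_int (c n) = - (\<Sum>i<n. of_int (c i) * y ^ (n - i))"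
    by (simp add: eq_neg_iff_add_eq_0)
  also have "\<dots> \<in> nonunits V"
  proof (intro nonunits_uminus[OF V] nonunits_sum[OF V])
    fix i assume "i \<in> {..<n}"
    then have "n - i = Suc (n - i - 1)" by simp
    then have eq: "of_int (c i) * y ^ (n - i) = y * (of_int (c i) * y ^ (n - i - 1))"
      by (metis mult.left_commute power_Suc)
    show "of_int (c i) * y ^ (n - i) \<in> nonunits V"
      unfolding eq
      by (intro nonunits_mult[OF V] y subring_mult[OF vr_subring[OF V]] subring_power[OF vr_subring[OF V]]
          subring_of_int[OF vr_subring[OF V]] nonunits_subset[OF V])
  qed
  finally show False using c of_int_in_nonunits_iff by blast
qed

end


section \<open>Elements of bounded degree over the rationals\<close>

text \<open>One bound for all of \<open>M\<close>, with integer coefficients so that divisibility by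
  primes can be tested on them. The coefficient \<open>c d\<close> may vanish, so the degree of
  \<open>w\<close> can be smaller than \<open>d\<close>.\<close>

definition degree_bounded :: "nat \<Rightarrow> 'a::field_char_0 set \<Rightarrow> bool" where
  "degree_bounded d M \<longleftrightarrow>
     (\<forall>w\<in>M. \<exists>c :: nat \<Rightarrow> int. (\<exists>i\<le>d. c i \<noteq> 0) \<and> (\<Sum>i\<le>d. of_int (c i) * w ^ i) = 0)"

lemma degree_boundedE:
  assumes "degree_bounded d M" "w \<in> M"
  obtains c :: "nat \<Rightarrow> int" where "\<exists>i\<le>d. c i \<noteq> 0" "(\<Sum>i\<le>d. of_int (c i) * w ^ i) = 0"
  using assms unfolding degree_bounded_def by blast

lemma clear_denominators:
  fixes q :: "'i \<Rightarrow> rat"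
  assumes "finite I"
  obtains N :: int and c :: "'i \<Rightarrow> int" where "N \<noteq> 0" "\<And>i. i \<in> I \<Longrightarrow> of_int (c i) = of_int N * q i"
proof -
  have "\<exists>N::int. N \<noteq> 0 \<and> (\<forall>i\<in>I. of_int N * q i \<in> \<int>)"
    using assms
  proof (induction I rule: finite_induct)
    case empty
    show ?case by (intro exI[of _ 1]) auto
  next
    case (insert i I)
    then obtain N :: int where N: "N \<noteq> 0" "\<forall>i\<in>I. of_int N * q i \<in> \<int>" by blast
    obtain a b where ab: "quotient_of (q i) = (a, b)" by (cases "quotient_of (q i)")
    have b: "b > 0" "q i = of_int a / of_int b"
      using quotient_of_denom_pos[OF ab] quotient_of_div[OF ab] by auto
    have "of_int (N * b) * q i = of_int (N * a)" using b by simp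
    moreover have "of_int (N * b) * q j \<in> \<int>" if "j \<in> I" for j
    proof -
      have "of_int b * (of_int N * q j) \<in> \<int>" using N(2) that Ints_mult[OF Ints_of_int] by blast
      then show ?thesis by (simp add: mult_ac)
    qed
    ultimately show ?case using N(1) b(1)
      by (intro exI[of _ "N * b"]) (metis Ints_of_int insertE less_irrefl mult_eq_0_iff)
  qed
  then obtain N :: int where N: "N \<noteq> 0" "\<forall>i\<in>I. \<exists>c::int. of_int N * q i = of_int c"
    by (auto simp: Ints_def image_iff)
  from bchoice[OF N(2)] that[OF N(1)] show ?thesis by metis
qed

text \<open>Products of spanning elements of \<open>K\<close> over the rationals and of
  \<open>M\<close> over \<open>K\<close> span a rational space containing \<open>M\<close>. With
  \<open>d\<close> such products, the \<open>d + 1\<close> powers of \<open>w\<close> up to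
  \<open>w ^ d\<close> satisfy a relation.\<close>

lemma degree_bounded_finite_extension:
  fixes K M :: "'a::field_char_0 set"
  assumes K: "number_field K" and M: "is_finite_extension K M"
  shows "\<exists>d. degree_bounded d M"
proof -
  interpret vs: vector_space "\<lambda>(q::rat) (x::'a). of_rat q * x"
    by unfold_locales (auto simp: algebra_simps of_rat_add of_rat_mult)
  obtain B where B: "finite B" "K = {\<Sum>b\<in>B. c b * b | c. \<forall>b\<in>B. c b \<in> \<rat>}"
    using K by (auto simp: number_field_def is_finite_extension_def)
  obtain C where C: "finite C" "M = {\<Sum>b\<in>C. c b * b | c. \<forall>b\<in>C. c b \<in> K}"
    using M by (auto simp: is_finite_extension_def)
  define T where "T = (\<lambda>(b, b'). b * b') ` (B \<times> C)"
  have T: "finite T" using B(1) C(1) by (simp add: T_def)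
  have KT: "k * c \<in> vs.span T" if "k \<in> K" "c \<in> C" for k c
  proof -
    obtain e where e: "\<forall>b\<in>B. e b \<in> \<rat>" "k = (\<Sum>b\<in>B. e b * b)" using \<open>k \<in> K\<close> B(2) by auto
    have "e b * b * c \<in> vs.span T" if b: "b \<in> B" for b
    proof -
      obtain r where "e b = of_rat r" using e(1) b by (auto elim: Rats_cases)
      moreover have "of_rat r * (b * c) \<in> vs.span T"
        using b \<open>c \<in> C\<close> by (intro vs.span_scale vs.span_base) (auto simp: T_def)
      ultimately show ?thesis by (simp add: mult.assoc)
    qed
    then show ?thesis unfolding e(2) sum_distrib_right by (intro vs.span_sum)
  qed
  have MT: "M \<subseteq> vs.span T" using KT by (auto simp: C(2) intro!: vs.span_sum)
  have pow: "w ^ i \<in> M" if "w \<in> M" for w i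
    using that M subring_power[of M] subfield_imp_subring[of M] unfolding is_finite_extension_def by blast
  define d where "d = card T"
  have "\<exists>c :: nat \<Rightarrow> int. (\<exists>i\<le>d. c i \<noteq> 0) \<and> (\<Sum>i\<le>d. of_int (c i) * w ^ i) = 0" if w: "w \<in> M" for w
  proof (cases "inj_on (\<lambda>i. w ^ i) {..d}")
    case False
    then obtain i j where ij: "i \<le> d" "j \<le> d" "i \<noteq> j" "w ^ i = w ^ j" by (auto simp: inj_on_def)
    \<comment> \<open>Coinciding powers give the relation \<open>w ^ i - w ^ j = 0\<close> directly;
      counting the set of powers against the dimension requires them to be distinct.\<close>
    define c :: "nat \<Rightarrow> int" where "c k = (if k = i then 1 else 0) - (if k = j then 1 else 0)" for k
    have "(\<Sum>k\<le>d. of_int (c k) * w ^ k) =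
        (\<Sum>k\<le>d. if k = i then w ^ k else 0) - (\<Sum>k\<le>d. if k = j then w ^ k else 0)"
      unfolding sum_subtractf[symmetric] by (rule sum.cong) (auto simp: c_def)
    also have "\<dots> = 0" using ij by simp
    finally show ?thesis using ij by (intro exI[of _ c]) (auto simp: c_def)
  next
    case True
    let ?S = "(\<lambda>i. w ^ i) ` {..d}"
    have "card ?S = Suc d" using True by (simp add: card_image)
    moreover have "?S \<subseteq> vs.span T" using pow[OF w] MT by blast
    ultimately have "vs.dependent ?S"
      using vs.independent_span_bound[OF T, of ?S] by (auto simp: d_def)
    then obtain u where u: "\<exists>v\<in>?S. u v \<noteq> 0" "(\<Sum>v\<in>?S. of_rat (u v) * v) = 0"
      by (auto simp: vs.dependent_finite)
    obtain N :: int and c :: "nat \<Rightarrow> int" where c: "N \<noteq> 0" "\<And>i. i \<in> {..d} \<Longrightarrow> of_int (c i) = of_int N * u (w ^ i)"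
      by (rule clear_denominators[of "{..d}" "\<lambda>i. u (w ^ i)"]) auto
    have cc: "(of_int (c i) :: 'a) = of_int N * of_rat (u (w ^ i))" if "i \<le> d" for i
      using c(2)[of i] that by (metis atMost_iff of_rat_mult of_rat_of_int_eq)
    have "(\<Sum>i\<le>d. of_int (c i) * w ^ i) = of_int N * (\<Sum>i\<le>d. of_rat (u (w ^ i)) * w ^ i)"
      by (simp add: sum_distrib_left cc mult.assoc)
    also have "\<dots> = 0" using u(2) by (simp add: sum.reindex[OF True])
    moreover obtain i where "i \<le> d" "u (w ^ i) \<noteq> 0" using u(1) by auto
    then have "c i \<noteq> 0" using c(2)[of i] c(1) by auto
    ultimately show ?thesis using \<open>i \<le> d\<close> by (intro exI[of _ c]) auto
  qed
  then show ?thesis unfolding degree_bounded_def by blast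
qed

section \<open>Values of the terms of a relation, and bounded ramification\<close>

context
  fixes V :: "'a::field set"
  assumes V: "valuation_ring V"
begin

text \<open>Divide by a term \<open>t j\<close> of largest absolute value. If no other term had the
  same value, the remaining quotients would be nonunits, yet they add up to
  \<open>- 1\<close>.\<close>

lemma equal_valuation_terms:
  assumes I: "finite I" "I \<noteq> {}" and t: "\<And>i. i \<in> I \<Longrightarrow> t i \<noteq> 0" and s: "sum t I = (0::'a)"
  shows "\<exists>i\<in>I. \<exists>j\<in>I. i \<noteq> j \<and> t i / t j \<in> V \<and> t j / t i \<in> V"
proof -
  note R = vr_subring[OF V]
  have "\<exists>j\<in>I. \<forall>i\<in>I. t i / t j \<in> V"
    using I t
  proof (induction I rule: finite_ne_induct)
    case (singleton i)
    then show ?case using subring_one[OF R] by simp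
  next
    case (insert k I)
    then obtain j where j: "j \<in> I" "\<forall>i\<in>I. t i / t j \<in> V" by auto
    have nz: "t j \<noteq> 0" "t k \<noteq> 0" using insert.prems j(1) by auto
    show ?case
    proof (cases "t k / t j \<in> V")
      case True then show ?thesis using j by auto
    next
      case False
      then have jk: "t j / t k \<in> V" using V unfolding valuation_ring_def by (metis inverse_divide)
      have "t i / t k \<in> V" if "i \<in> I" for i
        using subring_mult[OF R bspec[OF j(2) that] jk] nz by simp
      then show ?thesis using nz subring_one[OF R] by auto
    qed
  qed
  then obtain j where j: "j \<in> I" "\<forall>i\<in>I. t i / t j \<in> V" by blast
  have "\<exists>i\<in>I. i \<noteq> j \<and> t j / t i \<in> V"
  proof (rule ccontr)
    assume "\<not> ?thesis"
    then have "t i / t j \<in> nonunits V" if "i \<in> I - {j}" for i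
      using that nonunits_if_not_inverse[OF V, of "t j / t i"] by auto
    then have "(\<Sum>i\<in>I - {j}. t i / t j) \<in> nonunits V" by (intro nonunits_sum[OF V])
    moreover have "(\<Sum>i\<in>I - {j}. t i / t j) = - 1"
      using s t[OF j(1)] j(1) I(1) by (simp add: sum_divide_distrib[symmetric] sum_diff1)
    ultimately show False
      using nonunits_uminus[OF V] one_notin_nonunits[OF V] by fastforce
  qed
  then show ?thesis using j by blast
qed

lemma residue_power_one:
  assumes x: "x - 1 \<in> nonunits V" shows "x ^ m - 1 \<in> nonunits V"
proof (induction m)
  case 0 show ?case using nonunits_zero[OF V] by simp
next
  case (Suc m)
  have "x \<in> V" using subring_add[OF vr_subring[OF V] nonunits_subset[OF V x] subring_one[OF vr_subring[OF V]]] by simp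
  then have "(x ^ m - 1) * x + (x - 1) \<in> nonunits V"
    by (intro nonunits_add[OF V] nonunits_mult[OF V] Suc x)
  then show ?case by (simp add: algebra_simps)
qed

end

context
  fixes V :: "'a::field_char_0 set" and p :: nat
  assumes V: "valuation_ring V" and pV: "of_nat p \<in> nonunits V" and p: "prime p"
begin

text \<open>If \<open>e'\<close> exceeded \<open>e\<close>, cancelling \<open>p ^ e\<close> would
  exhibit \<open>u\<close> as a multiple of \<open>p\<close> in \<open>V\<close>.\<close>

lemma valuation_exponent_le:
  assumes q: "q \<in> V" and eq: "q * (of_int u' * of_nat p ^ e') = of_int u * of_nat p ^ e"
    and u: "\<not> int p dvd u"
  shows "e' \<le> e"
proof (rule ccontr)
  note R = vr_subring[OF V]
  assume "\<not> e' \<le> e"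
  then have "e' = e + Suc (e' - e - 1)" by simp
  then have "of_nat p ^ e' = (of_nat p ^ e * (of_nat p * of_nat p ^ (e' - e - 1)) :: 'a)"
    by (metis power_Suc power_add)
  then have "of_nat p ^ e * (of_nat p * (q * of_int u' * of_nat p ^ (e' - e - 1))) = (of_nat p ^ e * of_int u :: 'a)"
    using eq by (simp add: mult_ac)
  moreover have "of_nat p ^ e \<noteq> (0::'a)" using p prime_gt_0_nat by auto
  ultimately have "of_int u = of_nat p * (q * of_int u' * of_nat p ^ (e' - e - 1))"
    by (metis mult_left_cancel)
  also have "\<dots> \<in> nonunits V"
    by (intro nonunits_mult[OF V pV] subring_mult[OF R] subring_power[OF R] subring_of_int[OF R]
        subring_of_nat[OF R] q)
  finally show False using u of_int_in_nonunits_iff[OF V pV p] by blast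
qed

end

text \<open>The ramification bound. In an integer relation for \<open>w\<close>, two nonzero terms
  of different index have equal value at \<open>p\<close>. Their \<open>n\<close>-th powers are
  integers with exponents \<open>n * a i + r * i\<close> at \<open>p\<close>; equating these shows
  that \<open>n\<close> divides \<open>r * (j - i)\<close>, where
  \<open>0 < j - i \<le> d\<close>.\<close>

lemma radical_exponent_dvd:
  fixes w :: "'a::field_char_0"
  assumes d: "degree_bounded d M" and w: "w \<in> M" "w ^ n = of_nat p ^ r" and n: "n > 0" and p: "prime p"
  shows "n dvd r * fact d"
proof -
  obtain V :: "'a set" where V: "valuation_ring V" "of_nat p \<in> nonunits V"
    using valuation_ring_over_prime[OF p] by blast
  note R = vr_subring[OF V(1)]
  have w0: "w \<noteq> 0" using w(2) n p by (auto simp: zero_power dest: prime_gt_0_nat)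
  obtain c :: "nat \<Rightarrow> int" where c: "\<exists>i\<le>d. c i \<noteq> 0" "(\<Sum>i\<le>d. of_int (c i) * w ^ i) = 0"
    using d w(1) by (rule degree_boundedE)
  define I where "I = {i. i \<le> d \<and> c i \<noteq> 0}"
  define t where "t i = of_int (c i) * w ^ i" for i
  have "sum t I = (\<Sum>i\<le>d. of_int (c i) * w ^ i)"
    unfolding t_def by (intro sum.mono_neutral_left) (auto simp: I_def)
  then have s: "sum t I = 0" using c(2) by simp
  have "finite I" "I \<noteq> {}" using c(1) by (auto simp: I_def)
  moreover have t0: "t i \<noteq> 0" if "i \<in> I" for i using that w0 by (simp add: t_def I_def)
  ultimately obtain i j where ij: "i \<in> I" "j \<in> I" "i \<noteq> j" "t i / t j \<in> V" "t j / t i \<in> V"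
    using equal_valuation_terms[OF V(1) _ _ _ s] by blast
  define a where "a k = multiplicity (int p) (c k)" for k
  \<comment> \<open>Only \<open>w ^ n\<close> is known to be a power of \<open>p\<close>, so the
    terms are compared after raising them to the power \<open>n\<close>.\<close>
  have tn: "\<exists>u. \<not> int p dvd u \<and> t k ^ n = of_int u * of_nat p ^ (n * a k + r * k)" if k: "k \<in> I" for k
  proof -
    have "\<not> is_unit (int p)" using p by (simp add: prime_nat_iff)
    then obtain u where u: "c k = int p ^ a k * u" "\<not> int p dvd u"
      using multiplicity_decompose'[of "c k" "int p"] k unfolding a_def I_def by auto
    have "t k ^ n = of_int (c k) ^ n * (w ^ n) ^ k"
      by (simp add: t_def power_mult_distrib mult.commute flip: power_mult)
    also have "\<dots> = of_int (u ^ n) * of_nat p ^ (n * a k + r * k)"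
      by (simp add: u(1) w(2) power_mult_distrib power_add mult_ac flip: power_mult)
    finally show ?thesis
      using u(2) p by (intro exI[of _ "u ^ n"]) (auto simp: prime_dvd_power_iff n dest: prime_dvd_power)
  qed
  have le: "n * a j + r * j \<le> n * a i + r * i" if I: "i \<in> I" "j \<in> I" and ij: "t i / t j \<in> V" for i j
  proof -
    obtain u u' where u: "\<not> int p dvd u" "t i ^ n = of_int u * of_nat p ^ (n * a i + r * i)"
      "t j ^ n = of_int u' * of_nat p ^ (n * a j + r * j)" using tn[OF I(1)] tn[OF I(2)] by blast
    have "(t i / t j) ^ n \<in> V" using ij by (intro subring_power[OF R])
    moreover have "(t i / t j) ^ n * t j ^ n = t i ^ n" using t0[OF I(2)] by (simp add: power_divide)
    ultimately show ?thesis using valuation_exponent_le[OF V p _ _ u(1)] unfolding u(2,3) by blast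
  qed
  have eq: "n * a j + r * j = n * a i + r * i" using le ij by (meson le_antisym)
  have final: "n dvd r * fact d" if "i < j" "i \<le> d" "j \<le> d" "n * a j + r * j = n * a i + r * i" for i j
  proof -
    have "int r * (int j - int i) = int n * (int (a i) - int (a j))"
      using arg_cong[OF that(4), of int] by (simp add: algebra_simps)
    then have "int n dvd int r * int (j - i)" using that(1) by (simp add: of_nat_diff)
    then have "n dvd r * (j - i)" by (metis int_dvd_int_iff of_nat_mult)
    moreover have "j - i dvd fact d" using that by (intro dvd_fact) auto
    ultimately show ?thesis by (meson dvd_trans mult_dvd_mono dvd_refl)
  qed
  from ij(3) show ?thesis
  proof (cases "i < j")
    case True then show ?thesis using final[of i j] eq ij by (auto simp: I_def)
  next
    case False then show ?thesis using final[of j i] eq ij by (auto simp: I_def)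
  qed
qed

section \<open>Finite residue rings and divisible elements of number fields\<close>

context
  fixes V :: "'a::field_char_0 set" and p :: nat
  assumes V: "valuation_ring V" and pV: "of_nat p \<in> nonunits V" and p: "prime p"
begin

text \<open>The residue class of \<open>\<eta>\<close> generates a ring with at most \<open>p ^ d\<close> elements.\<close>

lemma residue_order:
  assumes d: "degree_bounded d M" and eta: "\<eta> \<in> M" "\<eta> \<in> V" "inverse \<eta> \<in> V" "\<eta> \<noteq> 0"
  shows "\<eta> ^ fact (p ^ d) - 1 \<in> nonunits V"
proof -
  note R = vr_subring[OF V]
  obtain c0 :: "nat \<Rightarrow> int" where c0: "\<exists>i\<le>d. c0 i \<noteq> 0" "(\<Sum>i\<le>d. of_int (c0 i) * \<eta> ^ i) = 0"
    using d eta(1) by (rule degree_boundedE)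
  \<comment> \<open>Dividing the relation by the content \<open>g\<close> leaves some coefficient
    prime to \<open>p\<close>.\<close>
  define g where "g = Gcd (c0 ` {..d})"
  have g0: "g \<noteq> 0" using c0(1) by (auto simp: g_def Gcd_0_iff)
  have "\<forall>i\<in>{..d}. \<exists>k. c0 i = g * k" unfolding g_def by (metis Gcd_dvd dvdE imageI)
  then obtain c where c: "\<And>i. i \<le> d \<Longrightarrow> c0 i = g * c i" by (metis atMost_iff)
  have "of_int g * (\<Sum>i\<le>d. of_int (c i) * \<eta> ^ i) = 0"
    using c0(2) by (simp add: sum_distrib_left c mult.assoc)
  then have csum: "(\<Sum>i\<le>d. of_int (c i) * \<eta> ^ i) = 0" using g0 by simp
  have "\<exists>i\<le>d. \<not> int p dvd c i"
  proof (rule ccontr)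
    assume "\<not> ?thesis"
    then have "int p * g dvd c0 i" if "i \<le> d" for i
      using that c[OF that] by (metis dvd_refl mult.commute mult_dvd_mono)
    then have "int p * g dvd g" unfolding g_def[symmetric] by (subst (2) g_def) (auto intro: Gcd_greatest)
    then show False using g0 p by (simp add: prime_nat_iff)
  qed
  \<comment> \<open>With \<open>e\<close> the last index whose coefficient is prime to
    \<open>p\<close>, the relation modulo nonunits has degree \<open>e\<close>, and multiplying by
    an inverse \<open>b\<close> of \<open>c e\<close> modulo \<open>p\<close> makes it
    monic.\<close>
  then obtain e where e: "e \<le> d" "\<not> int p dvd c e" and emax: "\<And>i. i \<le> d \<Longrightarrow> \<not> int p dvd c i \<Longrightarrow> i \<le> e"
    using Greatest_le_nat[of "\<lambda>i. i \<le> d \<and> \<not> int p dvd c i" _ d] GreatestI_nat[of "\<lambda>i. i \<le> d \<and> \<not> int p dvd c i" _ d]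
    by blast
  have "coprime (int p) (c e)" using e(2) p by (simp add: prime_imp_coprime)
  then obtain a b where ab: "a * int p + b * c e = 1" by (metis bezout_int coprime_imp_gcd_eq_1)
  have eqe: "\<eta> ^ e - (\<Sum>i<e. of_int (- (b * c i)) * \<eta> ^ i) \<in> nonunits V"
  proof -
    have "(\<Sum>i\<le>d. of_int (c i) * \<eta> ^ i) = (\<Sum>i\<le>e. of_int (c i) * \<eta> ^ i) + (\<Sum>i\<in>{e<..d}. of_int (c i) * \<eta> ^ i)"
      using e(1) by (subst sum.union_disjoint[symmetric]) (auto intro!: sum.cong)
    then have "(\<Sum>i\<le>e. of_int (c i) * \<eta> ^ i) = - (\<Sum>i\<in>{e<..d}. of_int (c i) * \<eta> ^ i)"
      using csum by (simp add: eq_neg_iff_add_eq_0)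
    also have "\<dots> \<in> nonunits V"
    proof (intro nonunits_uminus[OF V] nonunits_sum[OF V] nonunits_mult[OF V] subring_power[OF R] eta)
      fix i assume "i \<in> {e<..d}"
      then have "int p dvd c i" using emax[of i] by force
      then show "of_int (c i) \<in> nonunits V" using of_int_in_nonunits_iff[OF V pV p] by blast
    qed
    finally have 1: "(\<Sum>i\<le>e. of_int (c i) * \<eta> ^ i) * of_int b \<in> nonunits V"
      by (rule nonunits_mult[OF V _ subring_of_int[OF R]])
    have 2: "of_nat p * (of_int a * \<eta> ^ e) \<in> nonunits V"
      by (intro nonunits_mult[OF V pV] subring_mult[OF R] subring_of_int[OF R] subring_power[OF R] eta)
    have ab': "of_nat p * of_int a + of_int b * of_int (c e) = (1::'a)"
      using arg_cong[OF ab, of "of_int :: int \<Rightarrow> 'a"] by (simp add: mult.commute)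
    have "(\<Sum>i\<le>e. of_int (c i) * \<eta> ^ i) * of_int b + of_nat p * (of_int a * \<eta> ^ e)
       = (of_nat p * of_int a + of_int b * of_int (c e)) * \<eta> ^ e - (\<Sum>i<e. of_int (- (b * c i)) * \<eta> ^ i)"
      by (simp add: lessThan_Suc_atMost[symmetric] algebra_simps sum_distrib_left sum_negf)
    then show ?thesis using nonunits_add[OF V 1 2] by (simp add: ab')
  qed
  \<comment> \<open>The elements congruent, modulo nonunits, to integer combinations of
    \<open>\<eta> ^ i\<close> with \<open>i < e\<close>.\<close>
  define S where "S = {x. \<exists>n :: nat \<Rightarrow> int. x - (\<Sum>i<e. of_int (n i) * \<eta> ^ i) \<in> nonunits V}"
  have S_add: "x + y \<in> S" if "x \<in> S" "y \<in> S" for x y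
  proof -
    from that obtain n n' where n: "x - (\<Sum>i<e. of_int (n i) * \<eta> ^ i) \<in> nonunits V"
      "y - (\<Sum>i<e. of_int (n' i) * \<eta> ^ i) \<in> nonunits V" by (auto simp: S_def)
    have "x + y - (\<Sum>i<e. of_int (n i + n' i) * \<eta> ^ i) \<in> nonunits V"
      using nonunits_add[OF V n] by (simp add: algebra_simps sum.distrib)
    then show ?thesis unfolding S_def by (intro CollectI exI)
  qed
  have S_scale: "of_int k * x \<in> S" if "x \<in> S" for x k
  proof -
    from that obtain n where n: "x - (\<Sum>i<e. of_int (n i) * \<eta> ^ i) \<in> nonunits V" by (auto simp: S_def)
    have "of_int k * x - (\<Sum>i<e. of_int (k * n i) * \<eta> ^ i) \<in> nonunits V"
      using nonunits_mult[OF V n subring_of_int[OF R, of k]] by (simp add: algebra_simps sum_distrib_left)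
    then show ?thesis unfolding S_def by (intro CollectI exI)
  qed
  have S0: "x \<in> S" if "x \<in> nonunits V" for x
    unfolding S_def by (rule CollectI, rule exI[of _ "\<lambda>_. 0"]) (use that in simp)
  have S_sum: "sum f I \<in> S" if "\<And>i. i \<in> I \<Longrightarrow> f i \<in> S" for f :: "nat \<Rightarrow> 'a" and I
    using that by (induction I rule: infinite_finite_induct) (auto simp: S0[OF nonunits_zero[OF V]] S_add)
  have pow: "\<eta> ^ j \<in> S" for j
  proof (induction j rule: less_induct)
    case (less j)
    show ?case
    proof (cases "j < e")
      case True
      have "(\<Sum>i<e. of_int (if i = j then 1 else 0) * \<eta> ^ i) = (\<Sum>i<e. if i = j then \<eta> ^ i else 0)"
        by (rule sum.cong) auto
      also have "\<dots> = \<eta> ^ j" using True by simp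
      finally show ?thesis unfolding S_def
        by (intro CollectI exI[of _ "\<lambda>i. if i = j then 1 else 0"]) (simp add: nonunits_zero[OF V])
    next
      case False
      define z where "z = \<eta> ^ e - (\<Sum>i<e. of_int (- (b * c i)) * \<eta> ^ i)"
      have "\<eta> ^ j = \<eta> ^ e * \<eta> ^ (j - e)" using False by (simp flip: power_add)
      also have "\<dots> = z * \<eta> ^ (j - e) + (\<Sum>i<e. of_int (- (b * c i)) * \<eta> ^ i) * \<eta> ^ (j - e)"
        by (simp add: z_def algebra_simps)
      also have "(\<Sum>i<e. of_int (- (b * c i)) * \<eta> ^ i) * \<eta> ^ (j - e) =
          (\<Sum>i<e. of_int (- (b * c i)) * \<eta> ^ (i + (j - e)))"
        by (simp only: sum_distrib_right power_add mult.assoc)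
      also have "z * \<eta> ^ (j - e) + (\<Sum>i<e. of_int (- (b * c i)) * \<eta> ^ (i + (j - e))) \<in> S"
      proof (rule S_add)
        show "z * \<eta> ^ (j - e) \<in> S"
          using eqe by (intro S0 nonunits_mult[OF V] subring_power[OF R] eta) (simp add: z_def)
        show "(\<Sum>i<e. of_int (- (b * c i)) * \<eta> ^ (i + (j - e))) \<in> S"
          using False by (intro S_sum S_scale less) auto
      qed
      finally show ?thesis .
    qed
  qed
  have "\<exists>n. n \<in> {..<e} \<rightarrow>\<^sub>E {0..<int p} \<and> \<eta> ^ j - (\<Sum>i<e. of_int (n i) * \<eta> ^ i) \<in> nonunits V" for j
  proof -
    obtain n :: "nat \<Rightarrow> int" where n: "\<eta> ^ j - (\<Sum>i<e. of_int (n i) * \<eta> ^ i) \<in> nonunits V"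
      using pow[of j] by (auto simp: S_def)
    \<comment> \<open>Reducing coefficients modulo \<open>p\<close> changes the sum by a nonunit and
      leaves only \<open>p ^ e\<close> tuples; \<open>restrict\<close> fixes the values outside the
      index range so that the tuples form a finite set.\<close>
    define n' where "n' = restrict (\<lambda>i. n i mod int p) {..<e}"
    have "(\<Sum>i<e. of_int (n i - n' i) * \<eta> ^ i) \<in> nonunits V"
    proof (intro nonunits_sum[OF V] nonunits_mult[OF V] subring_power[OF R] eta)
      fix i assume "i \<in> {..<e}"
      then show "of_int (n i - n' i) \<in> nonunits V"
        unfolding of_int_in_nonunits_iff[OF V pV p] n'_def by (simp add: mod_eq_dvd_iff[symmetric])
    qed
    from nonunits_add[OF V n this] have "\<eta> ^ j - (\<Sum>i<e. of_int (n' i) * \<eta> ^ i) \<in> nonunits V"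
      by (simp add: algebra_simps sum_subtractf)
    moreover have "n' \<in> {..<e} \<rightarrow>\<^sub>E {0..<int p}"
      using p prime_gt_0_nat by (auto simp: n'_def)
    ultimately show ?thesis by blast
  qed
  then obtain n where n: "\<And>j. n j \<in> {..<e} \<rightarrow>\<^sub>E {0..<int p}"
    "\<And>j. \<eta> ^ j - (\<Sum>i<e. of_int (n j i) * \<eta> ^ i) \<in> nonunits V" by metis
  have "card ({..<e} \<rightarrow>\<^sub>E {0..<int p}) = p ^ e" by (subst card_PiE) auto
  moreover have fin: "finite ({..<e} \<rightarrow>\<^sub>E {0..<int p})" by (intro finite_PiE) auto
  moreover have "n ` {..p ^ e} \<subseteq> {..<e} \<rightarrow>\<^sub>E {0..<int p}" using n(1) by blast
  ultimately have "\<not> inj_on n {..p ^ e}"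
    using card_inj_on_le[of n "{..p ^ e}" "{..<e} \<rightarrow>\<^sub>E {0..<int p}"]
    by (metis card_atMost not_less_eq_eq order_refl)
  then obtain i j where "i \<le> p ^ e" "j \<le> p ^ e" "i \<noteq> j" "n i = n j"
    unfolding inj_on_def atMost_iff by blast
  then obtain i j where ij: "i < j" "j \<le> p ^ e" "n i = n j" by (metis nat_neq_iff)
  \<comment> \<open>By pigeonhole \<open>k \<le> p ^ e \<le> p ^ d\<close>. Passing from
    \<open>e\<close> to \<open>d\<close> makes the exponent \<open>fact (p ^ d)\<close> independent
    of \<open>\<eta>\<close>.\<close>
  define k where "k = j - i"
  have "\<eta> ^ j - \<eta> ^ i \<in> nonunits V"
    using nonunits_diff[OF V n(2)[of j] n(2)[of i]] ij(3) by simp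
  then have "(\<eta> ^ j - \<eta> ^ i) * inverse \<eta> ^ i \<in> nonunits V"
    by (intro nonunits_mult[OF V] subring_power[OF R] eta)
  moreover have "(\<eta> ^ j - \<eta> ^ i) * inverse \<eta> ^ i = \<eta> ^ k - 1"
    using eta(4) ij(1) by (simp add: k_def power_diff field_simps)
  ultimately have "\<eta> ^ k - 1 \<in> nonunits V" by simp
  moreover have "k dvd fact (p ^ d)"
  proof (rule dvd_fact)
    show "1 \<le> k" using ij by (simp add: k_def)
    have "p ^ e \<le> p ^ d" using e(1) p prime_ge_1_nat by (intro power_increasing) auto
    then show "k \<le> p ^ d" using ij by (simp add: k_def)
  qed
  then obtain m where "fact (p ^ d) = k * m" by (elim dvdE)
  ultimately show ?thesis using residue_power_one[OF V, of "\<eta> ^ k" m] by (simp add: power_mult)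
qed

end

text \<open>If \<open>y \<noteq> 1\<close>, then \<open>y\<close>, \<open>1/y\<close> and
  \<open>1/(y - 1)\<close> are integral at a valuation ring over some prime \<open>p\<close>. The
  root \<open>\<eta>\<close> of \<open>y\<close> is a unit there, so \<open>residue_order\<close>
  makes \<open>y - 1\<close> a nonunit, against the integrality of its inverse.\<close>

lemma divisible_in_number_field_eq_one:
  fixes M :: "'a::field_char_0 set"
  assumes d: "degree_bounded d M" and M: "is_subfield M" and y: "y \<noteq> 0"
    and pow: "\<And>p. prime p \<Longrightarrow> \<exists>\<eta>\<in>M. \<eta> ^ fact (p ^ d) = y"
  shows "y = 1"
proof (rule ccontr)
  assume y1: "y \<noteq> 1"
  note R = subfield_imp_subring[OF M]
  have yM: "y \<in> M" using pow[OF two_is_prime_nat] subring_power[OF R] by blast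
  have lead: "\<exists>c::nat \<Rightarrow> int. \<exists>n. c n \<noteq> 0 \<and> (\<Sum>i\<le>n. of_int (c i) * w ^ i) = 0" if w: "w \<in> M" for w
  proof -
    obtain c :: "nat \<Rightarrow> int" where c: "\<exists>i\<le>d. c i \<noteq> 0" "(\<Sum>i\<le>d. of_int (c i) * w ^ i) = 0"
      using d w by (rule degree_boundedE)
    obtain n where n: "n \<le> d" "c n \<noteq> 0" "\<And>i. i \<le> d \<Longrightarrow> c i \<noteq> 0 \<Longrightarrow> i \<le> n"
      using c(1) Greatest_le_nat[of "\<lambda>i. i \<le> d \<and> c i \<noteq> 0" _ d] GreatestI_nat[of "\<lambda>i. i \<le> d \<and> c i \<noteq> 0" _ d]
      by blast
    have "(\<Sum>i\<le>n. of_int (c i) * w ^ i) = (\<Sum>i\<le>d. of_int (c i) * w ^ i)"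
      using n(1) n(3) by (intro sum.mono_neutral_left) force+
    then show ?thesis using n(2) c(2) by auto
  qed
  have "y - 1 \<in> M" by (intro subring_diff[OF R] subring_one[OF R] yM)
  then have inM: "inverse y \<in> M" "inverse (y - 1) \<in> M" using M yM by (auto simp: is_subfield_def)
  obtain c1 :: "nat \<Rightarrow> int" and n1 where c1: "c1 n1 \<noteq> 0" "(\<Sum>i\<le>n1. of_int (c1 i) * y ^ i) = 0"
    using lead[OF yM] by blast
  obtain c2 :: "nat \<Rightarrow> int" and n2
    where c2: "c2 n2 \<noteq> 0" "(\<Sum>i\<le>n2. of_int (c2 i) * inverse y ^ i) = 0"
    using lead[OF inM(1)] by blast
  obtain c3 :: "nat \<Rightarrow> int" and n3
    where c3: "c3 n3 \<noteq> 0" "(\<Sum>i\<le>n3. of_int (c3 i) * inverse (y - 1) ^ i) = 0"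
    using lead[OF inM(2)] by blast
  \<comment> \<open>A prime exceeding the product of the three leading coefficients divides none of
    them.\<close>
  obtain p where p: "prime p" "p > nat \<bar>c1 n1 * c2 n2 * c3 n3\<bar>" using bigger_prime by blast
  have nd: "\<not> int p dvd c1 n1 * c2 n2 * c3 n3"
  proof
    assume "int p dvd c1 n1 * c2 n2 * c3 n3"
    then have "int p \<le> \<bar>c1 n1 * c2 n2 * c3 n3\<bar>" using c1(1) c2(1) c3(1) by (intro zdvd_imp_le) auto
    then show False using p(2) by linarith
  qed
  obtain V :: "'a set" where V: "valuation_ring V" "of_nat p \<in> nonunits V"
    using valuation_ring_over_prime[OF p(1)] by blast
  note vr = algebraic_in_valuation_ring[OF V p(1)]
  have yV: "y \<in> V" "inverse y \<in> V" "inverse (y - 1) \<in> V"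
    by (rule vr[OF c1(2)] vr[OF c2(2)] vr[OF c3(2)], use nd in auto)+
  obtain \<eta> where eta: "\<eta> \<in> M" "\<eta> ^ fact (p ^ d) = y" using pow[OF p(1)] by blast
  have "\<eta> \<in> V" "inverse \<eta> \<in> V"
    using root_in_valuation_ring[OF V(1), of _ "fact (p ^ d)"] eta(2) yV by (auto simp: power_inverse)
  moreover have "\<eta> \<noteq> 0" using eta(2) y by (auto simp: zero_power)
  ultimately have "y - 1 \<in> nonunits V" using residue_order[OF V p(1) d eta(1)] eta(2) by simp
  then show False using yV(3) y1 by (simp add: nonunits_def)
qed


section \<open>Roots of unity and radicals in solvable extensions\<close>

definition primitive_root :: "nat \<Rightarrow> 'a::field \<Rightarrow> bool" where
  "primitive_root n z \<longleftrightarrow> (\<forall>k. z ^ k = 1 \<longleftrightarrow> n dvd k)"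

lemma primitive_root_power: "primitive_root n z \<Longrightarrow> z ^ n = 1"
  by (simp add: primitive_root_def)

lemma primitive_root_power_eq_1_iff: "primitive_root n z \<Longrightarrow> z ^ k = 1 \<longleftrightarrow> n dvd k"
  by (simp add: primitive_root_def)

text \<open>For \<open>n = 0\<close> the definition also admits \<open>z = 0\<close>, hence the
  positivity of \<open>n\<close>.\<close>

lemma primitive_root_nonzero: "primitive_root n z \<Longrightarrow> n > 0 \<Longrightarrow> z \<noteq> 0"
  using primitive_root_power by (fastforce simp: zero_power)

text \<open>A root of \<open>1 + X + ... + X^(p-1)\<close> differs from \<open>1\<close>, where the
  value is \<open>p\<close>. If \<open>z ^ k = 1\<close> with \<open>p\<close> not dividing
  \<open>k\<close>, a Bezout relation would give \<open>z = 1\<close>.\<close>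

lemma primitive_root_prime_exists:
  assumes p: "prime p"
  shows "\<exists>z::'a::{alg_closed_field,field_char_0}. primitive_root p z"
proof -
  have p2: "p \<ge> 2" using p prime_ge_2_nat by blast
  obtain z :: 'a where z: "(\<Sum>k\<le>p - 1. 1 * z ^ k) = 0"
    using alg_closed[of "p - 1" "\<lambda>_. 1"] p2 by auto
  have "{..p - 1} = {..<p}" using p2 by auto
  with z have zs: "(\<Sum>k<p. z ^ k) = 0" by simp
  have z1: "z \<noteq> 1"
  proof
    assume "z = 1"
    with zs p2 show False by simp
  qed
  have zp: "z ^ p = 1" using zs power_diff_1_eq[of z p] by simp
  have "z ^ k = 1 \<longleftrightarrow> p dvd k" for k
  proof
    assume "p dvd k" then show "z ^ k = 1" using zp by (auto simp: power_mult)
  next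
    assume k: "z ^ k = 1"
    show "p dvd k"
    proof (rule ccontr)
      assume "\<not> p dvd k"
      then have c: "coprime k p" "k \<noteq> 0"
        using prime_imp_coprime[OF p] by (auto simp: coprime_commute intro!: gr0I)
      then obtain a b where "k * a = p * b + 1" using bezout_nat[of k p] by auto
      then have "(z ^ k) ^ a = (z ^ p) ^ b * z" by (simp flip: power_mult power_Suc2)
      then show False using k zp z1 by simp
    qed
  qed
  then show ?thesis by (auto simp: primitive_root_def)
qed

text \<open>Induction on prime factors: from order \<open>a\<close> to \<open>p * a\<close> by a
  \<open>p\<close>-th root when \<open>p\<close> divides \<open>a\<close>, and otherwise by
  multiplying with a root of order \<open>p\<close>.\<close>

lemma primitive_root_exists:
  assumes "n > 0"
  shows "\<exists>z::'a::{alg_closed_field,field_char_0}. primitive_root n z"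
proof -
  have "n > 0 \<longrightarrow> (\<exists>z::'a. primitive_root n z)"
  proof (induction n rule: prime_divisors_induct)
    case (unit x)
    then show ?case by (auto simp: primitive_root_def intro!: exI[of _ 1])
  next
    case (factor p a)
    show ?case
    proof
      assume "p * a > 0"
      then have a0: "a > 0" by simp
      with factor obtain z :: 'a where z: "primitive_root a z" by auto
      have p0: "p > 0" using factor(1) prime_gt_0_nat by blast
      show "\<exists>z::'a. primitive_root (p * a) z"
      proof (cases "p dvd a")
        case True
        obtain y where y: "y ^ p = z" using nth_root_exists[OF p0] by blast
        have "y ^ k = 1 \<longleftrightarrow> p * a dvd k" for k
        proof
          assume k: "y ^ k = 1"
          have "z ^ k = (y ^ k) ^ p" by (simp add: y[symmetric] mult.commute flip: power_mult)
          then have "a dvd k" using k z by (simp add: primitive_root_def)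
          with True have "p dvd k" by (rule dvd_trans)
          then obtain j where j: "k = p * j" by (elim dvdE)
          then have "z ^ j = 1" using k y by (simp add: power_mult)
          then show "p * a dvd k" using z j by (simp add: primitive_root_def)
        next
          assume "p * a dvd k"
          then obtain j where "k = p * a * j" by (elim dvdE)
          then show "y ^ k = 1" using y primitive_root_power[OF z] by (simp add: power_mult)
        qed
        then show ?thesis by (auto simp: primitive_root_def)
      next
        case False
        then have co: "coprime p a" using factor(1) by (simp add: prime_imp_coprime)
        obtain w :: 'a where w: "primitive_root p w" using primitive_root_prime_exists[OF factor(1)] by blast
        have "(w * z) ^ k = 1 \<longleftrightarrow> p * a dvd k" for k
        proof
          assume "p * a dvd k"
          then have "p dvd k" "a dvd k" by (auto dest: dvd_mult_left dvd_mult_right)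
          then have "w ^ k = 1" "z ^ k = 1"
            using primitive_root_power_eq_1_iff w z by blast+
          then show "(w * z) ^ k = 1" by (simp add: power_mult_distrib)
        next
          assume k: "(w * z) ^ k = 1"
          have e: "((w * z) ^ k) ^ j = w ^ (k * j) * z ^ (k * j)" for j
            by (simp add: power_mult power_mult_distrib)
          have "w ^ (k * p) = 1" "z ^ (k * a) = 1"
            using primitive_root_power_eq_1_iff[OF w] primitive_root_power_eq_1_iff[OF z] by simp_all
          then have "z ^ (k * p) = 1" "w ^ (k * a) = 1" using e[of p] e[of a] k by simp_all
          then have "a dvd k * p" "p dvd k * a"
            using primitive_root_power_eq_1_iff[OF w] primitive_root_power_eq_1_iff[OF z] by blast+
          then have "a dvd k" and pk: "p dvd k"
            using co coprime_dvd_mult_left_iff coprime_commute by blast+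
          with pk co show "p * a dvd k" by (intro divides_mult)
        qed
        then show ?thesis by (auto simp: primitive_root_def)
      qed
    qed
  qed simp
  with assms show ?thesis by blast
qed

text \<open>\<open>X^n - 1\<close> has at most \<open>n\<close> roots, and \<open>z\<close> already
  supplies \<open>n\<close> distinct powers.\<close>

lemma root_of_unity_eq_power:
  fixes z w :: "'a::field"
  assumes z: "primitive_root n z" and n: "n > 0" and w: "w ^ n = 1"
  shows "\<exists>i. w = z ^ i"
proof -
  let ?P = "monom 1 n - 1 :: 'a poly"
  have "coeff ?P n = 1" using n by (simp add: coeff_1)
  then have P0: "?P \<noteq> 0" by (metis coeff_0 zero_neq_one)
  have S: "{x. poly ?P x = 0} = {x. x ^ n = 1}" by (auto simp: poly_monom)
  have "degree ?P \<le> n" by (intro degree_diff_le degree_monom_le) simp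
  then have card: "card {x::'a. x ^ n = 1} \<le> n" "finite {x::'a. x ^ n = 1}"
    using card_poly_roots_bound[OF P0] poly_roots_finite[OF P0] unfolding S by simp_all
  have z0: "z \<noteq> 0" by (rule primitive_root_nonzero[OF z n])
  have aux: "False" if "i < j" "j < n" "z ^ i = z ^ j" for i j
  proof -
    have "z ^ (j - i) = 1" using that z0 by (simp add: power_diff)
    then have "n dvd j - i" using z by (simp add: primitive_root_def)
    then show False using that by (auto dest: dvd_imp_le)
  qed
  have inj: "inj_on (\<lambda>i. z ^ i) {..<n}"
    by (rule inj_onI) (metis aux lessThan_iff nat_neq_iff)
  have "(z ^ i) ^ n = 1" for i
    using primitive_root_power[OF z] by (metis mult.commute power_mult power_one)
  then have "(\<lambda>i. z ^ i) ` {..<n} \<subseteq> {x. x ^ n = 1}" by auto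
  then have "(\<lambda>i. z ^ i) ` {..<n} = {x. x ^ n = 1}"
    using card inj by (intro card_seteq) (auto simp: card_image)
  then show ?thesis using w by blast
qed

lemma sum_powers_primitive_root:
  assumes z: "primitive_root n z" and i: "0 < i" "i < n"
  shows "(\<Sum>j<n. z ^ (i * j)) = 0"
proof -
  have "z ^ i \<noteq> 1" using z i by (auto simp: primitive_root_def dest: dvd_imp_le)
  moreover have "(z ^ i) ^ n = 1"
    using primitive_root_power[OF z] by (metis mult.commute power_mult power_one)
  ultimately show ?thesis using power_diff_1_eq[of "z ^ i" n] by (simp add: power_mult)
qed

section \<open>Field embeddings and automorphisms as ring maps\<close>

context
  fixes E :: "'b::field set" and F :: "'a::field set" and f
  assumes f: "field_embedding E F f" and E: "is_subring E"
begin

lemma embedding_add: "x \<in> E \<Longrightarrow> y \<in> E \<Longrightarrow> f (x + y) = f x + f y"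
  and embedding_mult: "x \<in> E \<Longrightarrow> y \<in> E \<Longrightarrow> f (x * y) = f x * f y"
  and embedding_one: "f 1 = 1"
  using f by (auto simp: field_embedding_def)

lemma embedding_inj: "x \<in> E \<Longrightarrow> y \<in> E \<Longrightarrow> f x = f y \<longleftrightarrow> x = y"
  using f by (auto simp: field_embedding_def dest: inj_onD)

lemma embedding_zero: "f 0 = 0"
  using embedding_add[of 0 0] subring_zero[OF E] by (metis add_0_right add_left_cancel)

lemma embedding_eq_0_iff: "x \<in> E \<Longrightarrow> f x = 0 \<longleftrightarrow> x = 0"
  using embedding_inj[of x 0] subring_zero[OF E] embedding_zero by simp

lemma embedding_power: "x \<in> E \<Longrightarrow> f (x ^ n) = f x ^ n"
  by (induction n) (auto simp: embedding_one embedding_mult subring_power[OF E])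

lemma embedding_sum: "(\<And>i. i \<in> I \<Longrightarrow> h i \<in> E) \<Longrightarrow> f (sum h I) = (\<Sum>i\<in>I. f (h i))"
  by (induction I rule: infinite_finite_induct)
    (auto simp: embedding_zero embedding_add subring_sum[OF E])

lemma embedding_of_nat: "f (of_nat n) = of_nat n"
  by (induction n) (auto simp: embedding_zero embedding_add embedding_one subring_one[OF E] subring_of_nat[OF E])

end

lemma subring_UNIV: "is_subring UNIV"
  by (simp add: is_subring_def)

text \<open>Makes the facts on embeddings available for automorphisms. As \<open>K\<close> is an
  arbitrary set here, \<open>g 1 = 1\<close> is derived from injectivity and
  \<open>g 1 * g 1 = g 1\<close>.\<close>

lemma abs_galois_embedding:
  assumes g: "g \<in> carrier (abs_galois K)" shows "field_embedding UNIV UNIV g"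
proof -
  have h: "g (x + y) = g x + g y" "g (x * y) = g x * g y" and "inj g" for x y
    using g by (auto simp: carrier_abs_galois_iff bij_def)
  have "g 0 = 0" using h(1)[of 0 0] by (metis add_0_right add_left_cancel)
  then have "g 1 \<noteq> 0" using \<open>inj g\<close> by (metis injD zero_neq_one)
  then have "g 1 = 1" using h(2)[of 1 1] by (metis mult_1_right mult_left_cancel)
  then show ?thesis using h \<open>inj g\<close> by (auto simp: field_embedding_def)
qed

context
  fixes K :: "'a::field set" and g
  assumes g: "g \<in> carrier (abs_galois K)"
begin

lemmas galois_embedding_facts = abs_galois_embedding[OF g] subring_UNIV

lemma galois_add: "g (x + y) = g x + g y"
  and galois_mult: "g (x * y) = g x * g y"
  and galois_zero: "g 0 = 0"
  and galois_power: "g (x ^ n) = g x ^ n"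
  and galois_sum: "g (sum h I) = (\<Sum>i\<in>I. g (h i))"
  and galois_eq_0_iff: "g x = 0 \<longleftrightarrow> x = 0"
  by (simp_all add: embedding_add[OF galois_embedding_facts] embedding_mult[OF galois_embedding_facts]
      embedding_zero[OF galois_embedding_facts] embedding_power[OF galois_embedding_facts]
      embedding_sum[OF galois_embedding_facts] embedding_eq_0_iff[OF galois_embedding_facts])

lemma galois_uminus: "g (- x) = - g x"
  using galois_add[of x "- x"] galois_zero by (simp add: eq_neg_iff_add_eq_0 add.commute)

lemma galois_one: "g 1 = 1"
  by (rule embedding_one[OF galois_embedding_facts])

lemma galois_divide: "g (x / y) = g x / g y"
proof (cases "y = 0")
  case False
  then have "g (x / y) * g y = g x" by (simp flip: galois_mult)
  then show ?thesis using False galois_eq_0_iff by (simp add: field_simps)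
qed (simp add: galois_zero)

lemma galois_inverse: "g (inverse x) = inverse (g x)"
  using galois_divide[of 1 x] galois_one by (simp add: inverse_eq_divide)

end

section \<open>Stabilizers and closed commutator subgroups\<close>

text \<open>If \<open>g\<close> moves \<open>x\<close>, so does every automorphism agreeing with
  \<open>g\<close> on the finite extension \<open>K(x)\<close>, and these form a basic open
  set.\<close>

lemma closedin_stabilizer:
  assumes K: "ambient_algebraic_closure K"
  shows "closedin (krull_topology K) {g \<in> carrier (abs_galois K). g x = x}"
proof -
  note sub = ambient_algebraic_closureD(1,2)[OF K]
  have "openin (krull_topology K) {g \<in> carrier (abs_galois K). g x \<noteq> x}"
    unfolding openin_subopen[of _ "{g \<in> carrier (abs_galois K). g x \<noteq> x}"]
  proof
    fix g assume g: "g \<in> {g \<in> carrier (abs_galois K). g x \<noteq> x}"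
    let ?T = "{f \<in> carrier (abs_galois K). \<forall>y\<in>adjoin K x. f y = g y}"
    have "openin (krull_topology K) ?T"
      using g finite_extension_adjoin[OF K] by (intro openin_krull_basis) auto
    moreover have "g \<in> ?T" "?T \<subseteq> {g \<in> carrier (abs_galois K). g x \<noteq> x}"
      using g self_in_adjoin[OF sub(2)] by auto
    ultimately show "\<exists>T. openin (krull_topology K) T \<and> g \<in> T \<and> T \<subseteq> {g \<in> carrier (abs_galois K). g x \<noteq> x}"
      by blast
  qed
  moreover have "topspace (krull_topology K) - {g \<in> carrier (abs_galois K). g x = x} =
      {g \<in> carrier (abs_galois K). g x \<noteq> x}"
    by (auto simp: topspace_krull_topology[OF sub(1)])
  ultimately show ?thesis by (auto simp: closedin_def topspace_krull_topology[OF sub(1)])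
qed

lemma subgroup_stabilizer: "subgroup {g \<in> carrier (abs_galois K). g x = x} (abs_galois K)"
proof -
  interpret group "abs_galois K" by (rule group_abs_galois)
  show ?thesis
  proof (rule subgroupI)
    show "{g \<in> carrier (abs_galois K). g x = x} \<noteq> {}" using one_closed by auto
    fix g assume g: "g \<in> {g \<in> carrier (abs_galois K). g x = x}"
    then have "inv_into UNIV g x = x" by (metis (mono_tags) bij_inv_eq_iff carrier_abs_galois_iff mem_Collect_eq)
    then show "inv\<^bsub>abs_galois K\<^esub> g \<in> {g \<in> carrier (abs_galois K). g x = x}"
      using g inv_into_in_abs_galois by (auto simp: inv_abs_galois)
    fix h assume h: "h \<in> {g \<in> carrier (abs_galois K). g x = x}"
    then show "g \<otimes>\<^bsub>abs_galois K\<^esub> h \<in> {g \<in> carrier (abs_galois K). g x = x}"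
      using g h m_closed[of g h] by auto
  qed auto
qed

text \<open>If a subgroup acts on \<open>Z\<close> through commuting maps, its commutators fix \<open>Z\<close>, and so does the
  closed subgroup they generate because stabilizers are closed.\<close>

lemma closed_derived_fixes:
  assumes K: "ambient_algebraic_closure K" and H: "subgroup H (abs_galois K)"
    and stable: "\<And>h z. h \<in> H \<Longrightarrow> z \<in> Z \<Longrightarrow> h z \<in> Z"
    and comm: "\<And>g h z. g \<in> H \<Longrightarrow> h \<in> H \<Longrightarrow> z \<in> Z \<Longrightarrow> g (h z) = h (g z)"
    and z: "z \<in> Z" and f: "f \<in> krull_topology K closure_of (derived (abs_galois K) H)"
  shows "f z = z"
proof -
  interpret group "abs_galois K" by (rule group_abs_galois)
  interpret H: subgroup H "abs_galois K" by (rule H)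
  let ?St = "{g \<in> carrier (abs_galois K). g z = z}"
  have "derived_set (abs_galois K) H \<subseteq> ?St"
  proof
    fix c assume "c \<in> derived_set (abs_galois K) H"
    then obtain g h where gh: "g \<in> H" "h \<in> H"
      and c: "c = g \<otimes>\<^bsub>abs_galois K\<^esub> h \<otimes>\<^bsub>abs_galois K\<^esub> inv\<^bsub>abs_galois K\<^esub> g \<otimes>\<^bsub>abs_galois K\<^esub> inv\<^bsub>abs_galois K\<^esub> h"
      by (elim UN_E singletonE) (rule that)
    have gc: "g \<in> carrier (abs_galois K)" "h \<in> carrier (abs_galois K)" using gh H.subset by auto
    \<comment> \<open>The commutator sends \<open>z\<close> to \<open>g (h y)\<close>; exchanging
      \<open>g\<close> and \<open>h\<close> cancels both inverses.\<close>
    define y where "y = (inv\<^bsub>abs_galois K\<^esub> g) ((inv\<^bsub>abs_galois K\<^esub> h) z)"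
    have y: "y \<in> Z" unfolding y_def 
      by (rule stable[OF H.m_inv_closed[OF gh(1)] stable[OF H.m_inv_closed[OF gh(2)] z]])
    have inv: "k ((inv\<^bsub>abs_galois K\<^esub> k) v) = v" if "k \<in> carrier (abs_galois K)" for k v
      using that by (simp add: inv_abs_galois carrier_abs_galois_iff bij_def surj_f_inv_f)
    have "c z = g (h y)" by (simp add: c y_def)
    also have "\<dots> = h (g y)" by (rule comm[OF gh y])
    also have "\<dots> = z" by (simp add: y_def inv gc)
    finally have "c z = z" .
    moreover have "c \<in> carrier (abs_galois K)"
      unfolding c by (intro m_closed inv_closed gc)
    ultimately show "c \<in> ?St" by blast
  qed
  then have "derived (abs_galois K) H \<subseteq> ?St"
    unfolding derived_def by (rule generate_subgroup_incl[OF _ subgroup_stabilizer])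
  then have "krull_topology K closure_of (derived (abs_galois K) H) \<subseteq> ?St"
    by (rule closure_of_minimal[OF _ closedin_stabilizer[OF K]])
  then show ?thesis using f by blast
qed

section \<open>Fixed fields of the derived series\<close>

context
  fixes K :: "'a::{alg_closed_field,field_char_0} set"
  assumes K: "ambient_algebraic_closure K"
begin

lemma subgroup_galois_derived: "subgroup (galois_derived K i) (abs_galois K)"
  using normal_galois_derived[OF ambient_algebraic_closureD(1)[OF K]] by (rule normal_imp_subgroup)

lemma galois_derived_in_carrier: "g \<in> galois_derived K i \<Longrightarrow> g \<in> carrier (abs_galois K)"
  using subgroup.subset[OF subgroup_galois_derived] by blast

lemma galois_derived_Suc_subset: "galois_derived K (Suc i) \<subseteq> galois_derived K i"
proof -
  interpret group "abs_galois K" by (rule group_abs_galois)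
  have "closedin (krull_topology K) (galois_derived K i)"
  proof (cases i)
    case 0
    then show ?thesis
      using closedin_topspace[of "krull_topology K"]
        topspace_krull_topology[OF ambient_algebraic_closureD(1)[OF K]] by simp
  qed simp
  moreover have "derived (abs_galois K) (galois_derived K i) \<subseteq> galois_derived K i"
    by (rule derived_incl[OF order_refl subgroup_galois_derived])
  ultimately show ?thesis by (auto dest: closure_of_minimal)
qed

lemma step_field_mono: "i \<le> j \<Longrightarrow> step_field K i \<subseteq> step_field K j"
proof (induction j rule: dec_induct)
  case (step j)
  then show ?case using galois_derived_Suc_subset[of j] by (fastforce simp: step_field_def)
qed simp

lemma step_field_iff: "x \<in> step_field K i \<longleftrightarrow> (\<forall>g\<in>galois_derived K i. g x = x)"
  by (simp add: step_field_def)

lemma is_subfield_step_field: "is_subfield (step_field K i)"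
proof -
  have fx: "g x = x" if "x \<in> step_field K i" "g \<in> galois_derived K i" for g x
    using that unfolding step_field_iff by blast
  show ?thesis
    unfolding is_subfield_def
  proof (intro conjI ballI)
    show "0 \<in> step_field K i" "1 \<in> step_field K i"
      unfolding step_field_iff
      using galois_zero[OF galois_derived_in_carrier] galois_one[OF galois_derived_in_carrier] by blast+
  next
    fix x y assume x: "x \<in> step_field K i" and y: "y \<in> step_field K i"
    show "x + y \<in> step_field K i" "x * y \<in> step_field K i"
      unfolding step_field_iff
      by (intro ballI; simp add: galois_add[OF galois_derived_in_carrier] galois_mult[OF galois_derived_in_carrier]
          fx[OF x] fx[OF y])+
  next
    fix x assume x: "x \<in> step_field K i"
    show "- x \<in> step_field K i" "inverse x \<in> step_field K i"
      unfolding step_field_iff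
      by (intro ballI; simp add: galois_uminus[OF galois_derived_in_carrier]
          galois_inverse[OF galois_derived_in_carrier] fx[OF x])+
  qed
qed

lemma is_subring_step_field: "is_subring (step_field K i)"
  by (rule subfield_imp_subring[OF is_subfield_step_field])

lemma step_field_stable:
  assumes x: "x \<in> step_field K i" and g: "g \<in> carrier (abs_galois K)"
  shows "g x \<in> step_field K i"
proof -
  interpret group "abs_galois K" by (rule group_abs_galois)
  interpret N: normal "galois_derived K i" "abs_galois K"
    by (rule normal_galois_derived[OF ambient_algebraic_closureD(1)[OF K]])
  have "h (g x) = g x" if h: "h \<in> galois_derived K i" for h
  proof -
    have "inv_into UNIV g \<circ> h \<circ> g \<in> galois_derived K i"
      using N.inv_op_closed1[OF g h] by (simp add: inv_abs_galois[OF g])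
    then have "(inv_into UNIV g \<circ> h \<circ> g) x = x" using x by (auto simp: step_field_def)
    then show ?thesis using g by (metis carrier_abs_galois_iff bij_inv_eq_iff comp_apply)
  qed
  then show ?thesis by (simp add: step_field_def)
qed

text \<open>The layer from step \<open>i\<close> to step \<open>i + 1\<close> is abelian: the
  commutator of \<open>g\<close> and \<open>h\<close> fixes \<open>h (g x)\<close>, which stays in
  the step field, but evaluating it there gives \<open>g (h x)\<close>.\<close>

lemma galois_derived_commute:
  assumes g: "g \<in> galois_derived K i" and h: "h \<in> galois_derived K i" and x: "x \<in> step_field K (Suc i)"
  shows "g (h x) = h (g x)"
proof -
  interpret group "abs_galois K" by (rule group_abs_galois)
  note gc = galois_derived_in_carrier[OF g] galois_derived_in_carrier[OF h]
  let ?c = "g \<otimes>\<^bsub>abs_galois K\<^esub> h \<otimes>\<^bsub>abs_galois K\<^esub> inv\<^bsub>abs_galois K\<^esub> g \<otimes>\<^bsub>abs_galois K\<^esub> inv\<^bsub>abs_galois K\<^esub> h"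
  have "?c \<in> derived_set (abs_galois K) (galois_derived K i)" using g h by blast
  then have "?c \<in> derived (abs_galois K) (galois_derived K i)"
    unfolding derived_def by (rule generate.incl)
  moreover have "derived (abs_galois K) (galois_derived K i) \<subseteq> galois_derived K (Suc i)"
    unfolding closed_derived.simps
    by (rule closure_of_subset)
      (simp add: topspace_krull_topology[OF ambient_algebraic_closureD(1)[OF K]]
        derived_in_carrier subgroup.subset[OF subgroup_galois_derived])
  ultimately have "?c \<in> galois_derived K (Suc i)" by blast
  moreover have "\<forall>f\<in>galois_derived K (Suc i). f (h (g x)) = h (g x)"
    using step_field_stable[OF step_field_stable[OF x gc(1)] gc(2)] unfolding step_field_iff .
  ultimately have "?c (h (g x)) = h (g x)" by (rule bspec[rotated])
  moreover have "?c (h (g x)) = g (h x)"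
    using gc by (simp add: inv_abs_galois carrier_abs_galois_iff bij_def inv_f_f)
  ultimately show ?thesis by simp
qed

text \<open>Automorphisms act on the powers of a primitive root by exponents, so they commute on
  them, and \<open>closed_derived_fixes\<close> applies.\<close>

lemma root_of_unity_in_step_field:
  assumes n: "n > 0" and w: "w ^ n = 1" and i: "i \<ge> 1"
  shows "w \<in> step_field K i"
proof -
  interpret group "abs_galois K" by (rule group_abs_galois)
  obtain z :: 'a where z: "primitive_root n z" using primitive_root_exists[OF n] by blast
  have pw: "\<exists>k. x = z ^ k" if "x ^ n = 1" for x using root_of_unity_eq_power[OF z n that] .
  have "w \<in> step_field K 1"
    unfolding step_field_def
  proof (intro CollectI ballI)
    fix f assume "f \<in> galois_derived K 1"
    then have f: "f \<in> krull_topology K closure_of (derived (abs_galois K) (carrier (abs_galois K)))" by simp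
    show "f w = w"
    proof (rule closed_derived_fixes[OF K subgroup_self _ _ _ f, where Z = "{x. x ^ n = 1}"])
      show "w \<in> {x. x ^ n = 1}" using w by simp
      show st: "h x \<in> {x. x ^ n = 1}" if "h \<in> carrier (abs_galois K)" "x \<in> {x. x ^ n = 1}" for h x
        using that galois_power[OF that(1), of x n] galois_one[OF that(1)] by simp
      fix g h x assume g: "g \<in> carrier (abs_galois K)" and h: "h \<in> carrier (abs_galois K)"
        and x: "x \<in> {x::'a. x ^ n = 1}"
      have zz: "z \<in> {x. x ^ n = 1}" using primitive_root_power[OF z] by simp
      obtain a where a: "g z = z ^ a" using pw st[OF g zz] by blast
      obtain b where b: "h z = z ^ b" using pw st[OF h zz] by blast
      obtain c where "x = z ^ c" using pw x by blast
      with a b show "g (h x) = h (g x)"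
        by (simp add: galois_power[OF g] galois_power[OF h] mult_ac flip: power_mult)
    qed
  qed
  then show ?thesis using step_field_mono[OF i] by blast
qed

text \<open>The \<open>i\<close>-th derived group multiplies each \<open>n\<close>-th root of
  \<open>x ^ n\<close> by a root of unity. Since \<open>i \<ge> 1\<close> that factor is fixed by
  the group, so its elements commute on these roots.\<close>

lemma radical_in_step_field:
  assumes i: "i \<ge> 1" and n: "n > 0" and a: "x ^ n \<in> step_field K i"
  shows "x \<in> step_field K (Suc i)"
proof (cases "x = 0")
  case True
  then show ?thesis using subring_zero[OF is_subring_step_field] by simp
next
  case False
  show ?thesis
    unfolding step_field_def
  proof (intro CollectI ballI)
    fix f assume "f \<in> galois_derived K (Suc i)"
    then have f: "f \<in> krull_topology K closure_of (derived (abs_galois K) (galois_derived K i))" by simp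
    show "f x = x"
    proof (rule closed_derived_fixes[OF K subgroup_galois_derived _ _ _ f, where Z = "{y. y ^ n = x ^ n}"])
      show "x \<in> {y. y ^ n = x ^ n}" by simp
      show st: "h y \<in> {y. y ^ n = x ^ n}" if h: "h \<in> galois_derived K i" and y: "y \<in> {y. y ^ n = x ^ n}" for h y
        using y a h galois_power[OF galois_derived_in_carrier[OF h], of y n] by (auto simp: step_field_def)
      fix g h y assume g: "g \<in> galois_derived K i" and h: "h \<in> galois_derived K i"
        and y: "y \<in> {y. y ^ n = x ^ n}"
      have y0: "y \<noteq> 0" using y False n by (auto simp: zero_power)
      have w: "k y / y \<in> step_field K i" if "k \<in> galois_derived K i" for k
        using st[OF that y] y y0 False by (intro root_of_unity_in_step_field[OF n _ i]) (simp add: power_divide)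
      have fx: "k' (k y / y) = k y / y" if "k \<in> galois_derived K i" "k' \<in> galois_derived K i" for k k'
        using w[OF that(1)] that(2) unfolding step_field_def by blast
      have "g (h y) = g (h y / y * y)" using y0 by simp
      also have "\<dots> = h y / y * g y"
        by (simp only: galois_mult[OF galois_derived_in_carrier[OF g]] fx[OF h g])
      also have "\<dots> = h (g y / y * y)"
        by (simp only: galois_mult[OF galois_derived_in_carrier[OF h]] fx[OF g h]) simp
      also have "\<dots> = h (g y)" using y0 by simp
      finally show "g (h y) = h (g y)" .
    qed
  qed
qed

end


section \<open>Uniqueness of the embedding\<close>

context
  fixes K :: "'a::{alg_closed_field, field_char_0} set"
    and L :: "'b::{alg_closed_field, field_char_0} set"
    and i :: nat and F :: "'a set" and \<tau> \<rho> :: "'b \<Rightarrow> 'a"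
  assumes nf: "number_field K" and K: "ambient_algebraic_closure K"
    and L: "ambient_algebraic_closure L" and i: "i \<ge> 1"
    and tau: "field_embedding (step_field L (Suc i)) F \<tau>"
    and rho: "field_embedding (step_field L (Suc i)) F \<rho>"
    and intertwine: "\<And>g. g \<in> carrier (abs_galois K) \<Longrightarrow> \<exists>h\<in>carrier (abs_galois L).
      \<forall>x\<in>step_field L (Suc i). \<tau> (h x) = g (\<tau> x) \<and> \<rho> (h x) = g (\<rho> x)"
begin

abbreviation (input) "SL \<equiv> step_field L (Suc i)"

lemmas tau_facts = tau is_subring_step_field[OF L]
lemmas rho_facts = rho is_subring_step_field[OF L]

lemma step_field_in_S: "x \<in> step_field L i \<Longrightarrow> x \<in> SL"
  using step_field_mono[OF L, of i "Suc i"] by auto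

lemma root_of_unity_in_S: "w ^ n = 1 \<Longrightarrow> n > 0 \<Longrightarrow> w \<in> SL"
  using root_of_unity_in_step_field[OF L _ _ i] step_field_in_S by blast

text \<open>Roots of \<open>2\<close> detect the exponent \<open>c\<close> with
  \<open>\<tau> z = \<rho> z ^ c\<close>: an automorphism multiplies both
  \<open>\<rho> \<alpha> ^ c\<close> and \<open>\<tau> \<alpha>\<close> by the same power of
  \<open>\<tau> z\<close>, so their quotient \<open>u\<close> lies in \<open>K\<close>, where
  ramification at \<open>2\<close> is bounded.\<close>

lemma embeddings_agree_on_roots_of_unity:
  assumes N: "N > 0" and w: "w ^ N = (1::'b)"
  shows "\<tau> w = \<rho> w"
proof -
  obtain d where d: "degree_bounded d K"
    using degree_bounded_finite_extension[OF nf is_finite_extension_refl[OF ambient_algebraic_closureD(1)[OF K]]]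
    by blast
  \<comment> \<open>The factor \<open>fact d\<close> absorbs the loss in
    \<open>radical_exponent_dvd\<close>: from \<open>n dvd (c - 1) * fact d\<close> one gets
    \<open>N dvd c - 1\<close>.\<close>
  define n where "n = N * fact d"
  have n: "n > 0" using N by (simp add: n_def)
  obtain z :: 'b where z: "primitive_root n z" using primitive_root_exists[OF n] by blast
  have zS: "z \<in> SL" using root_of_unity_in_S[OF primitive_root_power[OF z] n] .
  obtain \<alpha> :: 'b where \<alpha>: "\<alpha> ^ n = of_nat 2" using nth_root_exists[OF n] by blast
  have "\<alpha> ^ n \<in> step_field L i"
    unfolding \<alpha> by (rule subring_of_nat[OF is_subring_step_field[OF L]])
  then have \<alpha>SL: "\<alpha> \<in> SL" by (rule radical_in_step_field[OF L i n])
  have \<alpha>0: "\<alpha> \<noteq> 0" using \<alpha> n by (auto simp: zero_power)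
  have "primitive_root n (\<rho> z)"
    unfolding primitive_root_def
  proof
    fix k
    have "\<rho> z ^ k = 1 \<longleftrightarrow> \<rho> (z ^ k) = \<rho> 1"
      by (simp add: embedding_power[OF rho_facts zS] embedding_one[OF rho_facts])
    also have "\<dots> \<longleftrightarrow> z ^ k = 1"
      by (intro embedding_inj[OF rho_facts] subring_power[OF is_subring_step_field[OF L]] zS
          subring_one[OF is_subring_step_field[OF L]])
    finally show "\<rho> z ^ k = 1 \<longleftrightarrow> n dvd k" using z by (simp add: primitive_root_def)
  qed
  note rz = this
  have "\<tau> z ^ n = 1"
    using primitive_root_power[OF z] embedding_power[OF tau_facts zS, of n] embedding_one[OF tau_facts] by simp
  then obtain c0 where c0: "\<tau> z = \<rho> z ^ c0" using root_of_unity_eq_power[OF rz n] by blast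
  \<comment> \<open>Adding \<open>n\<close> leaves the power of \<open>\<rho> z\<close> unchanged
    and makes \<open>c\<close> positive, so that \<open>c - 1\<close> is a genuine
    predecessor.\<close>
  define c where "c = c0 + n"
  have c: "\<tau> z = \<rho> z ^ c" using c0 primitive_root_power[OF rz] by (simp add: c_def power_add)
  have ta: "\<tau> \<alpha> ^ n = 2" "\<rho> \<alpha> ^ n = 2"
    using \<alpha> embedding_power[OF tau_facts \<alpha>SL, of n] embedding_power[OF rho_facts \<alpha>SL, of n]
      embedding_of_nat[OF tau_facts, of 2] embedding_of_nat[OF rho_facts, of 2] by simp_all
  define u where "u = \<rho> \<alpha> ^ c / \<tau> \<alpha>"
  have "c = Suc (c - 1)" using n by (simp add: c_def)
  then have "(2::'a) ^ c = 2 * 2 ^ (c - 1)" by (metis power_Suc)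
  moreover have "u ^ n = (\<rho> \<alpha> ^ n) ^ c / \<tau> \<alpha> ^ n"
    by (simp add: u_def power_divide mult.commute flip: power_mult)
  ultimately have un: "u ^ n = of_nat 2 ^ (c - 1)" by (simp add: ta)
  have "u \<in> K"
  proof (rule fixed_field_abs_galois[OF K])
    fix g assume g: "g \<in> carrier (abs_galois K)"
    obtain h where h: "h \<in> carrier (abs_galois L)"
      "\<And>x. x \<in> SL \<Longrightarrow> \<tau> (h x) = g (\<tau> x)" "\<And>x. x \<in> SL \<Longrightarrow> \<rho> (h x) = g (\<rho> x)"
      using intertwine[OF g] by blast
    have "h \<alpha> ^ n = h (of_nat 2)" using \<alpha> galois_power[OF h(1), of \<alpha> n] by simp
    also have "\<dots> = of_nat 2" by (rule embedding_of_nat[OF galois_embedding_facts[OF h(1)]])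
    finally have "(h \<alpha> / \<alpha>) ^ n = 1" using \<alpha> by (simp add: power_divide)
    then obtain b where "h \<alpha> / \<alpha> = z ^ b" using root_of_unity_eq_power[OF z n] by blast
    then have b: "h \<alpha> = z ^ b * \<alpha>" using \<alpha>0 by (simp add: field_simps)
    have zb: "z ^ b \<in> SL" by (intro subring_power[OF is_subring_step_field[OF L]] zS)
    have gt: "g (\<tau> \<alpha>) = \<tau> z ^ b * \<tau> \<alpha>"
      unfolding h(2)[OF \<alpha>SL, symmetric] b
      by (simp add: embedding_mult[OF tau_facts zb \<alpha>SL] embedding_power[OF tau_facts zS])
    have gr: "g (\<rho> \<alpha>) = \<rho> z ^ b * \<rho> \<alpha>"
      unfolding h(3)[OF \<alpha>SL, symmetric] b
      by (simp add: embedding_mult[OF rho_facts zb \<alpha>SL] embedding_power[OF rho_facts zS])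
    have "\<tau> z \<noteq> 0"
      using embedding_eq_0_iff[OF tau_facts zS] primitive_root_nonzero[OF z n] by simp
    moreover have "(\<rho> z ^ b) ^ c = \<tau> z ^ b" by (simp add: c mult.commute flip: power_mult)
    ultimately show "g u = u"
      by (simp add: u_def galois_divide[OF g] galois_power[OF g] gt gr power_mult_distrib)
  qed
  from radical_exponent_dvd[OF d this un n two_is_prime_nat]
  have "N dvd c - 1" by (simp add: n_def)
  have wS: "w \<in> SL" by (rule root_of_unity_in_S[OF w N])
  have "w ^ n = 1" using w by (simp add: n_def power_mult)
  then obtain b where b: "w = z ^ b" using root_of_unity_eq_power[OF z n] by blast
  have "\<tau> w = \<rho> w ^ c"
    by (simp add: b embedding_power[OF tau_facts zS] embedding_power[OF rho_facts zS] c mult.commute flip: power_mult)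
  also have "\<dots> = \<rho> w * \<rho> w ^ (c - 1)" using n by (metis \<open>c = Suc (c - 1)\<close> power_Suc)
  also have "\<rho> w ^ (c - 1) = 1"
  proof -
    have "\<rho> w ^ N = 1" using embedding_power[OF rho_facts wS, of N] w embedding_one[OF rho_facts] by simp
    then show ?thesis using \<open>N dvd c - 1\<close> by (auto simp: power_mult)
  qed
  finally show ?thesis by simp
qed

text \<open>As \<open>\<tau>\<close> and \<open>\<rho>\<close> agree on roots of unity, an
  automorphism fixing \<open>\<tau> a\<close> multiplies \<open>\<tau> \<beta>\<close> and
  \<open>\<rho> \<beta>\<close> by the same factor for every root \<open>\<beta>\<close> of
  \<open>\<alpha>\<close>. Thus \<open>\<tau> \<alpha> / \<rho> \<alpha>\<close> has roots of all
  the required orders in one number field.\<close>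

lemma embeddings_agree_on_radicals:
  assumes \<alpha>: "\<alpha> \<in> SL" and n: "n > 0" and a: "\<alpha> ^ n \<in> step_field L i"
  shows "\<tau> \<alpha> = \<rho> \<alpha>"
proof (cases "\<alpha> = 0")
  case True
  then show ?thesis by (simp add: embedding_zero[OF tau_facts] embedding_zero[OF rho_facts])
next
  case False
  define a where "a = \<alpha> ^ n"
  have aS: "a \<in> SL" using a step_field_in_S by (simp add: a_def)
  \<comment> \<open>\<open>M\<close> is chosen before \<open>p\<close> and \<open>k\<close>, so a
    single degree bound \<open>d\<close> serves all the roots extracted below.\<close>
  define M where "M = adjoin K (\<tau> a)"
  have fin: "is_finite_extension K M" unfolding M_def by (rule finite_extension_adjoin[OF K])
  then have M: "is_subfield M" "K \<subseteq> M" by (auto simp: is_finite_extension_def)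
  have aM: "ambient_algebraic_closure M" by (rule ambient_algebraic_closure_mono[OF K M])
  have taM: "\<tau> a \<in> M" unfolding M_def by (rule self_in_adjoin[OF ambient_algebraic_closureD(2)[OF K]])
  obtain d where d: "degree_bounded d M" using degree_bounded_finite_extension[OF nf fin] by blast
  have nz: "\<tau> \<alpha> \<noteq> 0" "\<rho> \<alpha> \<noteq> 0"
    using False embedding_eq_0_iff[OF tau_facts \<alpha>] embedding_eq_0_iff[OF rho_facts \<alpha>] by auto
  have "\<tau> \<alpha> / \<rho> \<alpha> = 1"
  proof (rule divisible_in_number_field_eq_one[OF d M(1)])
    show "\<tau> \<alpha> / \<rho> \<alpha> \<noteq> 0" using nz by simp
    fix p :: nat
    define k :: nat where "k = fact (p ^ d)"
    have k: "k > 0" by (simp add: k_def)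
    obtain \<beta> where \<beta>: "\<beta> ^ k = \<alpha>" using nth_root_exists[OF k] by blast
    have \<beta>a: "\<beta> ^ (k * n) = a" by (simp add: power_mult \<beta> a_def)
    have kn: "k * n > 0" using k n by simp
    have \<beta>SL: "\<beta> \<in> SL"
      using a \<beta>a by (intro radical_in_step_field[OF L i kn]) (simp add: a_def)
    have \<beta>0: "\<beta> \<noteq> 0" using \<beta> False k by (auto simp: zero_power)
    define \<eta> where "\<eta> = \<tau> \<beta> / \<rho> \<beta>"
    have "\<eta> ^ k = \<tau> \<alpha> / \<rho> \<alpha>"
      using embedding_power[OF tau_facts \<beta>SL, of k] embedding_power[OF rho_facts \<beta>SL, of k]
      by (simp add: \<eta>_def power_divide \<beta>)
    moreover have "\<eta> \<in> M"
    proof (rule fixed_field_abs_galois[OF aM])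
      fix g assume gM: "g \<in> carrier (abs_galois M)"
      then have g: "g \<in> carrier (abs_galois K)" using M(2) by (auto simp: carrier_abs_galois_iff)
      obtain h where h: "h \<in> carrier (abs_galois L)"
        "\<And>x. x \<in> SL \<Longrightarrow> \<tau> (h x) = g (\<tau> x)" "\<And>x. x \<in> SL \<Longrightarrow> \<rho> (h x) = g (\<rho> x)"
        using intertwine[OF g] by blast
      \<comment> \<open>Since \<open>g\<close> fixes \<open>\<tau> a\<close>, its counterpart
        \<open>h\<close> fixes \<open>a\<close>; this is what makes
        \<open>h \<beta> / \<beta>\<close> a root of unity.\<close>
      have "\<tau> (h a) = \<tau> a" using h(2)[OF aS] gM taM by (simp add: carrier_abs_galois_iff)
      then have ha: "h a = a"
        using embedding_inj[OF tau_facts step_field_stable[OF L aS h(1)] aS] by blast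
      define w where "w = h \<beta> / \<beta>"
      have "a \<noteq> 0" using \<beta>a \<beta>0 by auto
      moreover have "h \<beta> ^ (k * n) = a" using ha \<beta>a galois_power[OF h(1), of \<beta> "k * n"] by simp
      ultimately have w: "w ^ (k * n) = 1" by (simp add: w_def power_divide \<beta>a)
      have wS: "w \<in> SL" by (rule root_of_unity_in_S[OF w kn])
      have hb: "h \<beta> = w * \<beta>" using \<beta>0 by (simp add: w_def)
      have "\<tau> w = \<rho> w" by (rule embeddings_agree_on_roots_of_unity[OF kn w])
      moreover have "w \<noteq> 0" using w kn by (auto simp: zero_power)
      then have "\<rho> w \<noteq> 0" using embedding_eq_0_iff[OF rho_facts wS] by simp
      moreover have "g (\<tau> \<beta>) = \<tau> w * \<tau> \<beta>" "g (\<rho> \<beta>) = \<rho> w * \<rho> \<beta>"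
        using h(2)[OF \<beta>SL] h(3)[OF \<beta>SL] hb embedding_mult[OF tau_facts wS \<beta>SL] embedding_mult[OF rho_facts wS \<beta>SL]
        by simp_all
      ultimately show "g \<eta> = \<eta>" by (simp add: \<eta>_def galois_divide[OF g])
    qed
    ultimately show "\<exists>\<eta>\<in>M. \<eta> ^ fact (p ^ d) = \<tau> \<alpha> / \<rho> \<alpha>" unfolding k_def by blast
  qed
  then show ?thesis using nz by simp
qed

text \<open>An element on which \<open>\<tau>\<close> and \<open>\<rho>\<close> differ has a Lagrange resolvent on which they differ; iterating
  over finitely many elements of the abelian group acting on the orbit produces a common
  eigenvector, which is a radical.\<close>

lemma embeddings_agree:
  assumes x: "x \<in> SL" shows "\<tau> x = \<rho> x"
proof (rule ccontr)
  assume neq: "\<tau> x \<noteq> \<rho> x"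
  note R = is_subring_step_field[OF L]
  define A where "A = galois_derived L i"
  interpret A: subgroup A "abs_galois L" unfolding A_def by (rule subgroup_galois_derived[OF L])
  have Ac: "h \<in> carrier (abs_galois L)" if "h \<in> A" for h using that A.subset by blast
  have Aid: "id \<in> A" using A.one_closed by simp
  have Acomp: "g \<circ> h \<in> A" if "g \<in> A" "h \<in> A" for g h using A.m_closed[OF that] by simp
  have Apow: "h ^^ k \<in> A" if "h \<in> A" for h k
  proof (induction k)
    case (Suc k)
    show ?case unfolding funpow.simps by (rule Acomp[OF that Suc])
  qed (simp only: funpow.simps Aid)
  have Acomm: "g (h v) = h (g v)" if "g \<in> A" "h \<in> A" "v \<in> SL" for g h v
    using galois_derived_commute[OF L] that by (simp add: A_def)
  have Afix: "h v = v" if "h \<in> A" "v \<in> step_field L i" for h v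
    using that by (simp add: A_def step_field_iff[OF L])
  have AS: "h v \<in> SL" if "h \<in> A" "v \<in> SL" for h v using step_field_stable[OF L that(2) Ac[OF that(1)]] .
  define Orb where "Orb = (\<lambda>h. h x) ` A"
  have xO: "x \<in> Orb" unfolding Orb_def by (rule image_eqI[OF _ Aid]) simp
  have finO: "finite Orb"
  proof -
    obtain p where p: "p \<in> polys_over L" "p \<noteq> 0" "poly p x = 0"
      using ambient_algebraic_closureD(3)[OF L] by blast
    have "poly p (h x) = 0" if "h \<in> A" for h
    proof -
      have "h c = c" if "c \<in> L" for c using Ac[OF \<open>h \<in> A\<close>] that by (simp add: carrier_abs_galois_iff)
      then have "poly p (h x) = h (poly p x)"
        using p(1) by (simp add: poly_altdef polys_over_def galois_sum[OF Ac[OF that]]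
            galois_mult[OF Ac[OF that]] galois_power[OF Ac[OF that]])
      then show ?thesis using p(3) galois_zero[OF Ac[OF that]] by simp
    qed
    then have "Orb \<subseteq> {y. poly p y = 0}" by (auto simp: Orb_def)
    then show ?thesis using poly_roots_finite[OF p(2)] finite_subset by blast
  qed
  have AO: "h y \<in> Orb" if h: "h \<in> A" and y: "y \<in> Orb" for h y
  proof -
    obtain g where g: "g \<in> A" "y = g x" using y by (auto simp: Orb_def)
    show ?thesis unfolding Orb_def by (rule image_eqI[OF _ Acomp[OF h g(1)]]) (simp add: g(2))
  qed
  \<comment> \<open>Each element of \<open>A\<close> permutes \<open>Orb\<close> in cycles of length
    at most \<open>card Orb\<close>, so its \<open>n\<close>-th power is trivial there.\<close>
  define n :: nat where "n = fact (card Orb)"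
  have n: "n > 0" by (simp add: n_def)
  have period: "(h ^^ n) y = y" if h: "h \<in> A" and y: "y \<in> Orb" for h y
  proof -
    let ?f = "\<lambda>k. (h ^^ k) y"
    have "?f ` {..card Orb} \<subseteq> Orb" using AO[OF Apow[OF h] y] by blast
    then have "\<not> inj_on ?f {..card Orb}"
      using card_inj_on_le[of ?f "{..card Orb}" Orb] finO by (metis card_atMost not_less_eq_eq order_refl)
    then obtain a b where "a \<le> card Orb" "b \<le> card Orb" "a \<noteq> b" "?f a = ?f b"
      unfolding inj_on_def atMost_iff by blast
    then obtain a b where ab: "a < b" "b \<le> card Orb" "?f a = ?f b" by (metis nat_neq_iff)
    define k where "k = b - a"
    have "h ^^ b = h ^^ a \<circ> h ^^ k" using ab(1) by (simp add: k_def flip: funpow_add)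
    then have "(h ^^ a) y = (h ^^ a) ((h ^^ k) y)" using ab(3) by simp
    moreover have "inj (h ^^ a)" using Ac[OF Apow[OF h]] by (simp add: carrier_abs_galois_iff bij_def)
    ultimately have hk: "(h ^^ k) y = y" by (metis injD)
    have "k dvd n" unfolding n_def using ab by (intro dvd_fact) (auto simp: k_def)
    then obtain j where j: "n = k * j" by (elim dvdE)
    have "((h ^^ k) ^^ j) y = y" by (induction j) (auto simp: hk)
    then show ?thesis by (simp add: j funpow_mult mult.commute)
  qed
  \<comment> \<open>\<open>V\<close> plays the role of the extension of the \<open>i\<close>-th step
    field generated by \<open>x\<close>: the action of \<open>A\<close> on it depends only on the
    action on the finite set \<open>Orb\<close>, so every element of \<open>A\<close> has period
    \<open>n\<close> on \<open>V\<close>.\<close>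
  define V where "V = {v \<in> SL. \<forall>h\<in>A. \<forall>h'\<in>A. (\<forall>y\<in>Orb. h y = h' y) \<longrightarrow> h v = h' v}"
  have VS: "v \<in> SL" if "v \<in> V" for v using that by (simp add: V_def)
  have V_eq: "h v = h' v" if "v \<in> V" "h \<in> A" "h' \<in> A" "\<forall>y\<in>Orb. h y = h' y" for v h h'
    using that by (simp add: V_def)
  have xV: "x \<in> V" using x xO by (simp add: V_def)
  have V_act: "g v \<in> V" if v: "v \<in> V" and g: "g \<in> A" for v g
  proof -
    have "h (g v) = h' (g v)" if h: "h \<in> A" "h' \<in> A" "\<forall>y\<in>Orb. h y = h' y" for h h'
      using Acomm[OF h(1) g VS[OF v]] Acomm[OF h(2) g VS[OF v]] V_eq[OF v h] by simp
    then show ?thesis using AS[OF g VS[OF v]] by (simp add: V_def)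
  qed
  have V_scale: "c * v \<in> V" if v: "v \<in> V" and c: "c \<in> step_field L i" for v c
  proof -
    have "h (c * v) = h' (c * v)" if h: "h \<in> A" "h' \<in> A" "\<forall>y\<in>Orb. h y = h' y" for h h'
      using V_eq[OF v h] Afix[OF h(1) c] Afix[OF h(2) c]
      by (simp add: galois_mult[OF Ac[OF h(1)]] galois_mult[OF Ac[OF h(2)]])
    then show ?thesis using subring_mult[OF R step_field_in_S[OF c] VS[OF v]] by (simp add: V_def)
  qed
  have V_sum: "sum f I \<in> V" if f: "\<And>k. k \<in> I \<Longrightarrow> f k \<in> V" for f and I :: "nat set"
  proof -
    have "h (sum f I) = h' (sum f I)" if h: "h \<in> A" "h' \<in> A" "\<forall>y\<in>Orb. h y = h' y" for h h'
      using V_eq[OF f h] by (simp add: galois_sum[OF Ac[OF h(1)]] galois_sum[OF Ac[OF h(2)]])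
    moreover have "sum f I \<in> SL" by (rule subring_sum[OF R VS[OF f]])
    ultimately show ?thesis by (simp add: V_def)
  qed
  have V_period: "(h ^^ n) v = v" if "v \<in> V" "h \<in> A" for v h
    using V_eq[OF that(1) Apow[OF that(2)] Aid] period[OF that(2)] by simp
  have mu: "w \<in> step_field L i" if "w ^ n = 1" for w
    by (rule root_of_unity_in_step_field[OF L n that i])
  obtain z :: 'b where z: "primitive_root n z" using primitive_root_exists[OF n] by blast
  have zi: "z ^ k \<in> step_field L i" for k
    by (rule subring_power[OF is_subring_step_field[OF L] mu[OF primitive_root_power[OF z]]])
  have eigen: "\<exists>v\<in>V. \<tau> v \<noteq> \<rho> v \<and> (\<forall>h\<in>B. \<exists>w. w ^ n = 1 \<and> h v = w * v)"
    if "finite B" "B \<subseteq> A" for B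
    using that
  proof (induction B rule: finite_induct)
    case empty
    then show ?case using xV neq by auto
  next
    case (insert s B)
    then obtain v where v: "v \<in> V" "\<tau> v \<noteq> \<rho> v" "\<forall>h\<in>B. \<exists>w. w ^ n = 1 \<and> h v = w * v" by auto
    have s: "s \<in> A" and BA: "B \<subseteq> A" using insert.prems by auto
    \<comment> \<open>The Lagrange resolvents of \<open>v\<close> under \<open>s\<close>. Their sum
      over \<open>j\<close> is \<open>of_nat n * v\<close>, because the power sums of
      \<open>z\<close> vanish for \<open>0 < k < n\<close>; hence \<open>\<tau>\<close> and
      \<open>\<rho>\<close> differ on one of them.\<close>
    define u where "u j = (\<Sum>k<n. z ^ (k * j) * (s ^^ k) v)" for j
    have uV: "u j \<in> V" for j
      unfolding u_def by (rule V_sum[OF V_scale[OF V_act[OF v(1) Apow[OF s]] zi]])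
    have "(\<Sum>j<n. u j) = (\<Sum>k<n. (\<Sum>j<n. z ^ (k * j)) * (s ^^ k) v)"
      unfolding u_def sum_distrib_right by (rule sum.swap)
    also have "\<dots> = (\<Sum>k<n. if k = 0 then of_nat n * v else 0)"
      using sum_powers_primitive_root[OF z] by (intro sum.cong) auto
    also have "\<dots> = of_nat n * v" using n by simp
    finally have total: "(\<Sum>j<n. u j) = of_nat n * v" .
    have "\<exists>j<n. \<tau> (u j) \<noteq> \<rho> (u j)"
    proof (rule ccontr)
      assume "\<not> ?thesis"
      then have "(\<Sum>j<n. \<tau> (u j)) = (\<Sum>j<n. \<rho> (u j))" by simp
      then have "\<tau> (of_nat n * v) = \<rho> (of_nat n * v)"
        unfolding total[symmetric] by (simp add: embedding_sum[OF tau_facts] embedding_sum[OF rho_facts] VS[OF uV])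
      then have "of_nat n * \<tau> v = of_nat n * \<rho> v"
        by (simp add: embedding_mult[OF tau_facts subring_of_nat[OF R] VS[OF v(1)]] embedding_of_nat[OF tau_facts]
            embedding_mult[OF rho_facts subring_of_nat[OF R] VS[OF v(1)]] embedding_of_nat[OF rho_facts])
      then show False using v(2) n by simp
    qed
    then obtain j where j: "\<tau> (u j) \<noteq> \<rho> (u j)" by blast
    have "\<exists>w. w ^ n = 1 \<and> h (u j) = w * u j" if "h \<in> insert s B" for h
    proof (cases "h = s")
      case True
      let ?f = "\<lambda>k. z ^ (k * j) * (s ^^ k) v"
      \<comment> \<open>Multiplication by \<open>z ^ j\<close> shifts the index by one, and the
        boundary terms \<open>k = 0\<close> and \<open>k = n\<close> agree because \<open>s\<close>
        has period \<open>n\<close> on \<open>V\<close>.\<close>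
      have "z ^ j * s (u j) = (\<Sum>k<n. ?f (Suc k))"
        unfolding u_def
        by (simp add: galois_sum[OF Ac[OF s]] galois_mult[OF Ac[OF s]] Afix[OF s zi] sum_distrib_left
            power_add mult.assoc)
      also have "\<dots> = (\<Sum>k<n. ?f k) + ?f n - ?f 0"
        using sum.lessThan_Suc_shift[of ?f n] sum.lessThan_Suc[of ?f n] by (simp only: add_diff_cancel_left')
      also have "?f n = ?f 0"
        using V_period[OF v(1) s] primitive_root_power[OF z] by (simp add: power_mult)
      finally have "z ^ j * s (u j) = u j" by (simp add: u_def)
      moreover have "z ^ j \<noteq> 0" using primitive_root_nonzero[OF z n] by simp
      ultimately have "s (u j) = inverse (z ^ j) * u j" by (simp add: field_simps)
      moreover have "inverse (z ^ j) ^ n = 1"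
        using primitive_root_power[OF z]
        by (metis inverse_1 mult.commute power_inverse power_mult power_one)
      ultimately show ?thesis using True by blast
    next
      case False
      then have hB: "h \<in> B" using that by blast
      then have h: "h \<in> A" using BA by blast
      obtain w where w: "w ^ n = 1" "h v = w * v" using v(3) hB by blast
      \<comment> \<open>Earlier eigenvalues survive: \<open>h\<close> commutes with
        \<open>s\<close>, and \<open>w\<close>, an \<open>n\<close>-th root of unity, is fixed by
        powers of \<open>s\<close>.\<close>
      have "h ((s ^^ k) v) = w * (s ^^ k) v" for k
        unfolding Acomm[OF h Apow[OF s] VS[OF v(1)]] w(2)
        by (simp add: galois_mult[OF Ac[OF Apow[OF s]]] Afix[OF Apow[OF s] mu[OF w(1)]])
      then have "h (u j) = w * u j"
        unfolding u_def
        by (simp add: galois_sum[OF Ac[OF h]] galois_mult[OF Ac[OF h]] Afix[OF h zi] sum_distrib_left mult_ac)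
      then show ?thesis using w(1) by blast
    qed
    then show ?case using uV j by blast
  qed
  \<comment> \<open>There are finitely many restrictions to \<open>Orb\<close>, so a finite
    \<open>B\<close> represents the action of all of \<open>A\<close> on \<open>V\<close>; an
    eigenvector of \<open>B\<close> is then one of \<open>A\<close>, and its \<open>n\<close>-th
    power is fixed.\<close>
  have "(\<lambda>h. restrict h Orb) ` A \<subseteq> Orb \<rightarrow>\<^sub>E Orb" using AO by auto
  then have "finite ((\<lambda>h. restrict h Orb) ` A)"
    by (rule finite_subset) (intro finite_PiE finO)
  from finite_subset_image[OF this order_refl]
  obtain B where B: "B \<subseteq> A" "finite B" "(\<lambda>h. restrict h Orb) ` A = (\<lambda>h. restrict h Orb) ` B"
    by (elim exE conjE) (rule that)
  obtain v where v: "v \<in> V" "\<tau> v \<noteq> \<rho> v" "\<forall>h\<in>B. \<exists>w. w ^ n = 1 \<and> h v = w * v"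
    using eigen[OF B(2,1)] by blast
  have "v ^ n \<in> step_field L i"
    unfolding step_field_iff[OF L]
  proof
    fix h assume "h \<in> galois_derived L i"
    then have h: "h \<in> A" by (simp add: A_def)
    then obtain s where s: "s \<in> B" "restrict h Orb = restrict s Orb" using B(3) by blast
    then have "\<forall>y\<in>Orb. h y = s y" by (metis restrict_apply')
    then have "h v = s v" using V_eq[OF v(1) h] s(1) B(1) by blast
    moreover obtain w where "w ^ n = 1" "s v = w * v" using v(3) s(1) by blast
    ultimately show "h (v ^ n) = v ^ n"
      by (simp add: galois_power[OF Ac[OF h]] power_mult_distrib)
  qed
  then have "\<tau> v = \<rho> v" by (rule embeddings_agree_on_radicals[OF VS[OF v(1)] n])
  with v(2) show False by blast
qed

end

theorem theorem5p3:
  fixes K :: "'a::{alg_closed_field, field_char_0} set"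
    and L :: "'b::{alg_closed_field, field_char_0} set"
    and m :: nat
    and \<sigma> :: "('a \<Rightarrow> 'a) set \<Rightarrow> ('b \<Rightarrow> 'b) set"
    and \<tau> \<rho> :: "'b \<Rightarrow> 'a"
  assumes "number_field K" and "ambient_algebraic_closure K"
    and "number_field L" and "ambient_algebraic_closure L"
    and "m \<ge> 2"
    and "\<sigma> \<in> hom (step_galois K m) (step_galois L m)"
    and "continuous_map (step_topology K m) (step_topology L m) \<sigma>"
    and "openin (step_topology L m) (\<sigma> ` carrier (step_galois K m))"
    and "closed_derived (step_galois L m) (step_topology L m) (m - 1)
           \<subseteq> \<sigma> ` carrier (step_galois K m)"
    and "field_embedding (step_field L m) (step_field K m) \<tau>"
    and "field_embedding (step_field L m) (step_field K m) \<rho>"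
    and "\<forall>g\<in>carrier (step_galois K m). \<forall>x\<in>step_field L m.
           \<tau> (step_act (\<sigma> g) x) = step_act g (\<tau> x)"
    and "\<forall>g\<in>carrier (step_galois K m). \<forall>x\<in>step_field L m.
           \<rho> (step_act (\<sigma> g) x) = step_act g (\<rho> x)"
  shows "\<forall>x\<in>step_field L m. \<tau> x = \<rho> x"
proof -
  obtain i where m: "m = Suc i" and i: "i \<ge> 1" using \<open>m \<ge> 2\<close> by (cases m) auto
  note sub = ambient_algebraic_closureD(1)[OF assms(2)] ambient_algebraic_closureD(1)[OF assms(4)]
  \<comment> \<open>A representative \<open>h\<close> of the image under \<open>\<sigma>\<close> of
    the coset of \<open>g\<close> serves \<open>\<tau>\<close> and \<open>\<rho>\<close>
    simultaneously, which turns the condition on cosets into one on automorphisms.\<close>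
  have lift: "\<exists>h\<in>carrier (abs_galois L). \<forall>x\<in>step_field L m. \<tau> (h x) = g (\<tau> x) \<and> \<rho> (h x) = g (\<rho> x)"
    if g: "g \<in> carrier (abs_galois K)" for g
  proof -
    let ?c = "galois_derived K m #>\<^bsub>abs_galois K\<^esub> g"
    have c: "?c \<in> carrier (step_galois K m)"
      using g by (auto simp: step_quotient_def FactGroup_def RCOSETS_def)
    then have "\<sigma> ?c \<in> carrier (step_galois L m)"
      using assms(6) by (auto simp: hom_def)
    then obtain h where h: "h \<in> carrier (abs_galois L)" "\<sigma> ?c = galois_derived L m #>\<^bsub>abs_galois L\<^esub> h"
      by (auto simp: step_quotient_def FactGroup_def RCOSETS_def)
    have "\<tau> (h x) = g (\<tau> x) \<and> \<rho> (h x) = g (\<rho> x)" if x: "x \<in> step_field L m" for x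
    proof -
      have "\<tau> x \<in> step_field K m" "\<rho> x \<in> step_field K m"
        using assms(10,11) x by (auto simp: field_embedding_def)
      then show ?thesis
        using assms(12,13) c x step_act_coset[OF sub(1) _ g] step_act_coset[OF sub(2) x h(1)] h(2)
        by metis
    qed
    then show ?thesis using h(1) by blast
  qed
  show ?thesis
    using embeddings_agree[OF assms(1,2,4) i assms(10)[unfolded m] assms(11)[unfolded m] lift[unfolded m]]
    unfolding m by blast
qed

end
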